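(* In the setting described in the context, let $s\in\mathbb R$ and let $w=(w_\omega)_{\omega\in\Omega}$ be a positive profile (all $w_\omega>0$) with $\lambda_\Omega(w)>\max\{s,0\}$. Then every $\mathcal C\subseteq X$ with $t(x,y)\le s$ for all distinct $x,y\in\mathcal C$ satisfies $$|\mathcal C|\le\frac{1-s}{d_E\,(\lambda_\Omega(w)-s)}\,\mathcal D_{\mathrm{eff}}(w).$$ Consequently, $|\mathcal C|$ is at most the infimum of the right-hand side over all positive profiles $w$ with $\lambda_\Omega(w)>\max\{s,0\}$.
   Context: Setting. A finite group $G$ acts transitively on a finite set $X$; $o\in X$; $H=\mathrm{Stab}_G(o)$. $W$ is a (finite-dimensional complex) unitary $G$-representation and $x\mapsto\ell_x\in W$ is a $G$-equivariant map with $\|\ell_x\|=1$; it is assumed that $t(x,y)=\langle\ell_x,\ell_y\rangle$ is real for all $x,y$. $E$ is an irreducible unitary $H$-representation, $d_E=\dim E$. $\Omega$ is a nonempty finite index set of pairwise inequivalent irreducible unitary $G$-representations $V_\omega$ such that $\dim\mathrm{Hom}_H(E,\mathrm{Res}^G_HV_\omega)=1$ for each $\omega\in\Omega$; $D_\omega=\dim V_\omega$. Choose isometric $H$-embeddings $\phi_{\omega,o}:E\to V_\omega$. Whenever $V_{\omega'}$ occurs in $W\otimes V_\omega$ ($\omega,\omega'\in\Omega$), choose an isometric $G$-intertwiner $C_{\omega,\omega'}:V_{\omega'}\to W\otimes V_\omega$. By Schur's lemma there is a scalar $c_{\omega,\omega'}$ with $C_{\omega,\omega'}^*(\ell_o\otimes\phi_{\omega,o}u)=c_{\omega,\omega'}\phi_{\omega',o}u$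 for all $u\in E$; phases are chosen so that $c_{\omega,\omega'}\ge0$. Put $p_{\omega,\omega'}=c_{\omega,\omega'}^2$, and $p_{\omega,\omega'}=0$ if $V_{\omega'}$ does not occur in $W\otimes V_\omega$. Assume the balance identity $D_\omega p_{\omega,\omega'}=D_{\omega'}p_{\omega',\omega}$ for all $\omega,\omega'\in\Omega$. For a positive profile $w$: $$\lambda_\Omega(w)=\min_{\nu\in\Omega}\frac{\sum_{\omega\in\Omega}p_{\omega,\nu}w_\omega}{w_\nu},\qquad \mathcal D_{\mathrm{eff}}(w)=\frac{\big(\sum_{\omega\in\Omega}w_\omega\big)^2}{\sum_{\omega\in\Omega}w_\omega^2/D_\omega}.$$ *)

theory Defs
  imports
    "HOL-Algebra.Group_Action"
    "HOL-Library.Extended_Real"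
    "HOL-Library.Nonpos_Ints"
    "Jordan_Normal_Form.VS_Connect"
    "Jordan_Normal_Form.Schur_Decomposition"
begin

text \<open>
  A finite-dimensional unitary representation is given in orthonormal coordinates: the space is
  \<open>\<complex>\<^sup>n\<close> with its standard inner product \<open>\<bullet>c\<close>, and group elements act by unitary matrices.
  Keeping the dimension as a value rather than in the type allows families of representations
  of different dimensions.
\<close>

record 'g rep =
  rdim :: nat
  rmat :: "'g \<Rightarrow> complex mat"

definition isometric :: "complex mat \<Rightarrow> bool" where
  "isometric A \<longleftrightarrow> mat_adjoint A * A = 1\<^sub>m (dim_col A)"

definition unitary_rep :: "('g, 'm) monoid_scheme \<Rightarrow> 'g rep \<Rightarrow> bool" where
  "unitary_rep G V \<longleftrightarrow>
     (\<forall>g\<in>carrier G. rmat V g \<in> carrier_mat (rdim V) (rdim V) \<and> isometric (rmat V g)) \<and>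
     rmat V \<one>\<^bsub>G\<^esub> = 1\<^sub>m (rdim V) \<and>
     (\<forall>g\<in>carrier G. \<forall>h\<in>carrier G. rmat V (g \<otimes>\<^bsub>G\<^esub> h) = rmat V g * rmat V h)"

definition irreducible_rep :: "('g, 'm) monoid_scheme \<Rightarrow> 'g rep \<Rightarrow> bool" where
  "irreducible_rep G V \<longleftrightarrow> 0 < rdim V \<and>
     (\<forall>S. VectorSpace.subspace class_ring S (module_vec TYPE(complex) (rdim V)) \<and>
          (\<forall>g\<in>carrier G. \<forall>v\<in>S. rmat V g *\<^sub>v v \<in> S)
        \<longrightarrow> S = {0\<^sub>v (rdim V)} \<or> S = carrier_vec (rdim V))"

definition intertwiners :: "('g, 'm) monoid_scheme \<Rightarrow> 'g rep \<Rightarrow> 'g rep \<Rightarrow> complex mat set" where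
  "intertwiners G U V =
     {T \<in> carrier_mat (rdim V) (rdim U). \<forall>g\<in>carrier G. T * rmat U g = rmat V g * T}"

definition hom_dim :: "('g, 'm) monoid_scheme \<Rightarrow> 'g rep \<Rightarrow> 'g rep \<Rightarrow> nat" where
  "hom_dim G U V = vectorspace.dim class_ring
     ((module_mat TYPE(complex) (rdim V) (rdim U))\<lparr>carrier := intertwiners G U V\<rparr>)"

definition equivalent_rep :: "('g, 'm) monoid_scheme \<Rightarrow> 'g rep \<Rightarrow> 'g rep \<Rightarrow> bool" where
  "equivalent_rep G U V \<longleftrightarrow> (\<exists>T\<in>intertwiners G U V. invertible_mat T)"

text \<open>
  \<open>V\<close> occurs in \<open>U\<close> if \<open>U\<close> has a subrepresentation equivalent to \<open>V\<close>, namely the image of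
  an injective intertwiner.
\<close>

definition occurs_in :: "('g, 'm) monoid_scheme \<Rightarrow> 'g rep \<Rightarrow> 'g rep \<Rightarrow> bool" where
  "occurs_in G V U \<longleftrightarrow>
     (\<exists>T\<in>intertwiners G V U. inj_on (\<lambda>v. T *\<^sub>v v) (carrier_vec (rdim V)))"

text \<open>
  \<open>\<complex>\<^sup>m \<otimes> \<complex>\<^sup>n\<close> is identified with \<open>\<complex>\<^bsup>m * n\<^esup>\<close> via \<open>e\<^sub>i \<otimes> e\<^sub>j \<mapsto> e\<^bsub>i * n + j\<^esub>\<close>
  (Kronecker product).
\<close>

definition tensor_vec :: "complex vec \<Rightarrow> complex vec \<Rightarrow> complex vec" where
  "tensor_vec u v = vec (dim_vec u * dim_vec v)
     (\<lambda>i. u $ (i div dim_vec v) * v $ (i mod dim_vec v))"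

definition tensor_mat :: "complex mat \<Rightarrow> complex mat \<Rightarrow> complex mat" where
  "tensor_mat A B = mat (dim_row A * dim_row B) (dim_col A * dim_col B)
     (\<lambda>(i, j). A $$ (i div dim_row B, j div dim_col B) * B $$ (i mod dim_row B, j mod dim_col B))"

definition tensor_rep :: "'g rep \<Rightarrow> 'g rep \<Rightarrow> 'g rep" where
  "tensor_rep U V =
     \<lparr>rdim = rdim U * rdim V, rmat = (\<lambda>g. tensor_mat (rmat U g) (rmat V g))\<rparr>"

text \<open>
  The scalar \<open>c\<close> with \<open>C\<^sup>* (l \<otimes> A u) = c B u\<close> for all \<open>u\<close>. Here \<open>A\<close> and \<open>B\<close> are the embeddings
  of the \<open>H\<close>-representation \<open>E\<close> into \<open>V\<^sub>\<omega>\<close> and \<open>V\<^sub>\<omega>\<^sub>'\<close>; existence is Schur's lemma.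
\<close>

definition schur_scalar ::
  "complex mat \<Rightarrow> complex vec \<Rightarrow> complex mat \<Rightarrow> complex mat \<Rightarrow> complex" where
  "schur_scalar C l A B = (THE c. \<forall>u\<in>carrier_vec (dim_col A).
     mat_adjoint C *\<^sub>v tensor_vec l (A *\<^sub>v u) = c \<cdot>\<^sub>v (B *\<^sub>v u))"

definition profile_eigenvalue ::
  "'i set \<Rightarrow> ('i \<Rightarrow> 'i \<Rightarrow> real) \<Rightarrow> ('i \<Rightarrow> real) \<Rightarrow> real" where
  "profile_eigenvalue \<Omega> p w = Min ((\<lambda>\<nu>. (\<Sum>\<omega>\<in>\<Omega>. p \<omega> \<nu> * w \<omega>) / w \<nu>) ` \<Omega>)"

definition effective_dim :: "'i set \<Rightarrow> ('i \<Rightarrow> nat) \<Rightarrow> ('i \<Rightarrow> real) \<Rightarrow> real" where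
  "effective_dim \<Omega> D w = (\<Sum>\<omega>\<in>\<Omega>. w \<omega>)\<^sup>2 / (\<Sum>\<omega>\<in>\<Omega>. (w \<omega>)\<^sup>2 / real (D \<omega>))"

end

theory Submission
  imports Defs
begin

text \<open>
  For \<open>x = g\<^sub>x x\<^sub>0\<close> let \<open>\<Phi>\<^bsub>\<omega>,x\<^esub> = g\<^sub>x \<phi>\<^sub>\<omega>\<close> and consider the operator-valued kernel
  \<open>F(x, y) = (\<Sum>\<omega>. w\<^sub>\<omega> \<Phi>\<^bsub>\<omega>,x\<^esub>\<^sup>* \<Phi>\<^bsub>\<omega>,y\<^esub>)\<close>. Projecting the vectors \<open>l\<^sub>x \<otimes> \<Phi>\<^bsub>\<omega>,x\<^esub> a\<^sub>x\<close> to the pairwise orthogonal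
  copies of the \<open>V\<^sub>\<omega>\<^sub>'\<close> in \<open>W \<otimes> V\<^sub>\<omega>\<close> shows by Bessel's inequality that \<open>(t - \<lambda>) F\<close> is positive semidefinite.
  Its pairing with \<open>F\<close> gives \<open>0 \<le> (\<Sum>x y. (t(x, y) - \<lambda>) \<parallel>F(x, y)\<parallel>\<^sup>2)\<close> in the Hilbert-Schmidt norm,
  hence \<open>(\<lambda> - s) (\<Sum>x y. \<parallel>F(x, y)\<parallel>\<^sup>2) \<le> (1 - s) N d (\<Sum>\<omega>. w\<^sub>\<omega>)\<^sup>2\<close> for a code with \<open>N\<close> points and \<open>d = dim E\<close>.
  Passing to the frame operator, which has the same Hilbert-Schmidt norm, and applying Cauchy-Schwarz
  to the diagonal of each of its blocks bounds the sum on the left below by \<open>N\<^sup>2 d\<^sup>2 (\<Sum>\<omega>. w\<^sub>\<omega>\<^sup>2 / D\<^sub>\<omega>)\<close>.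
\<close>

section \<open>Kernel inequality\<close>

lemma of_real_cmod_power2: "(complex_of_real (cmod z))\<^sup>2 = z * cnj z"
  by (metis complex_norm_square of_real_power)

text \<open>Cyclicity of the trace: the squared Hilbert-Schmidt norm of the Gram kernel
  \<open>F\<close> on \<open>J\<close> equals that of the frame matrix on \<open>I\<close>, whose
  entries have modulus \<open>sqrt (u k * u k') * cmod (R k k')\<close> with \<open>R\<close> the
  inner products of the rows of \<open>M\<close>. The bound keeps only the diagonal of the frame
  matrix.\<close>

lemma gram_diagonal_le:
  fixes M :: "'k \<Rightarrow> 'j \<Rightarrow> complex" and u :: "'k \<Rightarrow> real"
  assumes "finite I" and u: "\<And>k. k \<in> I \<Longrightarrow> 0 \<le> u k"
  defines "F \<equiv> \<lambda>j j'. \<Sum>k\<in>I. of_real (u k) * (cnj (M k j) * M k j')"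
  shows "(\<Sum>k\<in>I. (u k)\<^sup>2 * (\<Sum>j\<in>J. (cmod (M k j))\<^sup>2)\<^sup>2) \<le> (\<Sum>j\<in>J. \<Sum>j'\<in>J. (cmod (F j j'))\<^sup>2)"
proof -
  define R where "R k k' = (\<Sum>j\<in>J. cnj (M k j) * M k' j)" for k k'
  have "complex_of_real (\<Sum>j\<in>J. \<Sum>j'\<in>J. (cmod (F j j'))\<^sup>2) = (\<Sum>j\<in>J. \<Sum>j'\<in>J. F j j' * cnj (F j j'))"
    by (simp add: of_real_cmod_power2)
  also have "\<dots> = (\<Sum>j\<in>J. \<Sum>j'\<in>J. \<Sum>k\<in>I. \<Sum>k'\<in>I.
      of_real (u k * u k') * ((cnj (M k j) * M k' j) * cnj (cnj (M k j') * M k' j')))"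
    unfolding F_def cnj_sum sum_product by (intro sum.cong refl) (simp add: mult_ac)
  \<comment> \<open>The sums over \<open>j\<close> and \<open>j'\<close> are moved inside, where
    they factor as \<open>R k k'\<close> times its conjugate.\<close>
  also have "\<dots> = (\<Sum>j\<in>J. \<Sum>k\<in>I. \<Sum>j'\<in>J. \<Sum>k'\<in>I.
      of_real (u k * u k') * ((cnj (M k j) * M k' j) * cnj (cnj (M k j') * M k' j')))"
    by (intro sum.cong refl sum.swap)
  also have "\<dots> = (\<Sum>k\<in>I. \<Sum>j\<in>J. \<Sum>j'\<in>J. \<Sum>k'\<in>I.
      of_real (u k * u k') * ((cnj (M k j) * M k' j) * cnj (cnj (M k j') * M k' j')))"
    by (rule sum.swap)
  also have "\<dots> = (\<Sum>k\<in>I. \<Sum>j\<in>J. \<Sum>k'\<in>I. \<Sum>j'\<in>J.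
      of_real (u k * u k') * ((cnj (M k j) * M k' j) * cnj (cnj (M k j') * M k' j')))"
    by (intro sum.cong refl sum.swap)
  also have "\<dots> = (\<Sum>k\<in>I. \<Sum>k'\<in>I. \<Sum>j\<in>J. \<Sum>j'\<in>J.
      of_real (u k * u k') * ((cnj (M k j) * M k' j) * cnj (cnj (M k j') * M k' j')))"
    by (intro sum.cong refl sum.swap)
  also have "\<dots> = (\<Sum>k\<in>I. \<Sum>k'\<in>I. of_real (u k * u k') * (R k k' * cnj (R k k')))"
    unfolding R_def cnj_sum sum_product unfolding sum_distrib_left ..
  also have "\<dots> = complex_of_real (\<Sum>k\<in>I. \<Sum>k'\<in>I. u k * u k' * (cmod (R k k'))\<^sup>2)"
    by (simp add: of_real_cmod_power2)
  finally have eq: "(\<Sum>j\<in>J. \<Sum>j'\<in>J. (cmod (F j j'))\<^sup>2) = (\<Sum>k\<in>I. \<Sum>k'\<in>I. u k * u k' * (cmod (R k k'))\<^sup>2)"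
    by (simp only: of_real_eq_iff)
  have R_diag: "cmod (R k k) = (\<Sum>j\<in>J. (cmod (M k j))\<^sup>2)" for k
  proof -
    have "R k k = of_real (\<Sum>j\<in>J. (cmod (M k j))\<^sup>2)"
      by (simp add: R_def of_real_cmod_power2 mult.commute)
    then show ?thesis by (simp only: norm_of_real) (simp add: sum_nonneg)
  qed
  show ?thesis
    unfolding eq
  proof (rule sum_mono)
    fix k assume k: "k \<in> I"
    have "u k * u k * (cmod (R k k))\<^sup>2 \<le> (\<Sum>k'\<in>I. u k * u k' * (cmod (R k k'))\<^sup>2)"
      using assms(1) k u by (intro member_le_sum) auto
    then show "(u k)\<^sup>2 * (\<Sum>j\<in>J. (cmod (M k j))\<^sup>2)\<^sup>2 \<le> (\<Sum>k'\<in>I. u k * u k' * (cmod (R k k'))\<^sup>2)"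
      by (simp add: R_diag power2_eq_square)
  qed
qed

text \<open>\<open>F\<close> is a sum of rank-one kernels, one for each row of \<open>M\<close>.
  Hence its pairing with the entrywise product of \<tau> and \<open>F\<close> is a sum, with weights
  \<open>u k\<close>, of values of the form in \<open>psd\<close> at the conjugated rows of
  \<open>M\<close>.\<close>

lemma psd_pairing_nonneg:
  fixes M :: "'k \<Rightarrow> 'j \<Rightarrow> complex" and u :: "'k \<Rightarrow> real" and \<tau> :: "'j \<Rightarrow> 'j \<Rightarrow> real"
  assumes u: "\<And>k. k \<in> I \<Longrightarrow> 0 \<le> u k"
  defines "F \<equiv> \<lambda>j j'. \<Sum>k\<in>I. of_real (u k) * (cnj (M k j) * M k j')"
  assumes psd: "\<And>b. 0 \<le> Re (\<Sum>j\<in>J. \<Sum>j'\<in>J. of_real (\<tau> j j') * (cnj (b j) * F j j' * b j'))"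
  shows "0 \<le> (\<Sum>j\<in>J. \<Sum>j'\<in>J. \<tau> j j' * (cmod (F j j'))\<^sup>2)"
proof -
  have "0 \<le> (\<Sum>k\<in>I. u k * Re (\<Sum>j\<in>J. \<Sum>j'\<in>J. of_real (\<tau> j j') * (M k j * F j j' * cnj (M k j'))))"
    using psd[of "\<lambda>j. cnj (M k j)" for k] u by (intro sum_nonneg mult_nonneg_nonneg) auto
  also have "\<dots> = Re (\<Sum>k\<in>I. \<Sum>j\<in>J. \<Sum>j'\<in>J. of_real (u k * \<tau> j j') * (M k j * F j j' * cnj (M k j')))"
    by (simp add: Re_sum sum_distrib_left algebra_simps)
  also have "(\<Sum>k\<in>I. \<Sum>j\<in>J. \<Sum>j'\<in>J. of_real (u k * \<tau> j j') * (M k j * F j j' * cnj (M k j'))) =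
     (\<Sum>j\<in>J. \<Sum>k\<in>I. \<Sum>j'\<in>J. of_real (u k * \<tau> j j') * (M k j * F j j' * cnj (M k j')))"
    by (rule sum.swap)
  also have "\<dots> = (\<Sum>j\<in>J. \<Sum>j'\<in>J. \<Sum>k\<in>I. of_real (u k * \<tau> j j') * (M k j * F j j' * cnj (M k j')))"
    by (intro sum.cong refl sum.swap)
  also have "\<dots> = (\<Sum>j\<in>J. \<Sum>j'\<in>J. of_real (\<tau> j j') * (F j j' * cnj (F j j')))"
  proof (intro sum.cong refl)
    fix j j'
    have "cnj (F j j') = (\<Sum>k\<in>I. of_real (u k) * (M k j * cnj (M k j')))"
      by (simp add: F_def)
    then show "(\<Sum>k\<in>I. of_real (u k * \<tau> j j') * (M k j * F j j' * cnj (M k j'))) =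
        of_real (\<tau> j j') * (F j j' * cnj (F j j'))"
      by (simp add: sum_distrib_left mult_ac)
  qed
  also have "\<dots> = of_real (\<Sum>j\<in>J. \<Sum>j'\<in>J. \<tau> j j' * (cmod (F j j'))\<^sup>2)"
    by (simp add: of_real_cmod_power2)
  finally show ?thesis by simp
qed

text \<open>The part of the argument that is free of representations. Column \<open>e\<close> of the
  matrix \<open>f \<omega> x\<close> is the image of the \<open>e\<close>-th basis vector of E under
  the embedding at \<open>x\<close>, and \<open>psd\<close> says in these coordinates that (t - lam)
  F is positive semidefinite. The squared Hilbert-Schmidt norm \<open>S\<close> of F is bounded
  above through the pairing and below through the frame operator.\<close>

lemma frame_code_bound:
  fixes f :: "'i \<Rightarrow> 'x \<Rightarrow> nat \<Rightarrow> nat \<Rightarrow> complex" and w :: "'i \<Rightarrow> real" and t :: "'x \<Rightarrow> 'x \<Rightarrow> real"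
  assumes fin: "finite K" "K \<noteq> {}" "finite \<Omega>" "\<Omega> \<noteq> {}"
    and w: "\<And>\<omega>. \<omega> \<in> \<Omega> \<Longrightarrow> 0 < w \<omega>"
    and D: "\<And>\<omega>. \<omega> \<in> \<Omega> \<Longrightarrow> 0 < D \<omega>" and d: "0 < d"
    and ortho: "\<And>\<omega> x e e'. \<omega> \<in> \<Omega> \<Longrightarrow> x \<in> K \<Longrightarrow> e < d \<Longrightarrow> e' < d \<Longrightarrow>
      (\<Sum>i<D \<omega>. cnj (f \<omega> x i e) * f \<omega> x i e') = (if e = e' then 1 else 0)"
    and t_diag: "\<And>x. x \<in> K \<Longrightarrow> t x x = 1"
    and t_le: "\<And>x y. x \<in> K \<Longrightarrow> y \<in> K \<Longrightarrow> x \<noteq> y \<Longrightarrow> t x y \<le> s"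
    and sl: "s < lam"
    and psd: "\<And>a. lam * (\<Sum>\<omega>\<in>\<Omega>. w \<omega> * (\<Sum>i<D \<omega>. (cmod (\<Sum>x\<in>K. \<Sum>e<d. f \<omega> x i e * a x e))\<^sup>2))
      \<le> Re (\<Sum>\<omega>\<in>\<Omega>. of_real (w \<omega>) * (\<Sum>x\<in>K. \<Sum>y\<in>K. of_real (t x y) *
          (\<Sum>i<D \<omega>. cnj (\<Sum>e<d. f \<omega> x i e * a x e) * (\<Sum>e<d. f \<omega> y i e * a y e))))"
  shows "real (card K) \<le> (1 - s) / (real d * (lam - s)) * effective_dim \<Omega> D w"
proof -
  \<comment> \<open>\<open>J\<close> pairs a code point with a coordinate of E and indexes the
    kernel; \<open>I\<close> pairs \<omega> with a coordinate of its representation space and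
    indexes the frame operator. \<open>M\<close> is the matrix between them.\<close>
  define J where "J = K \<times> {..<d}"
  define I where "I = Sigma \<Omega> (\<lambda>\<omega>. {..<D \<omega>})"
  define M where "M k j = f (fst k) (fst j) (snd k) (snd j)" for k j
  define u where "u k = w (fst k)" for k :: "'i \<times> nat"
  define F where "F = (\<lambda>j j'. \<Sum>k\<in>I. of_real (u k) * (cnj (M k j) * M k j'))"
  define S where "S = (\<Sum>j\<in>J. \<Sum>j'\<in>J. (cmod (F j j'))\<^sup>2)"
  define P where "P = (\<Sum>\<omega>\<in>\<Omega>. w \<omega>)"
  define Q where "Q = (\<Sum>\<omega>\<in>\<Omega>. (w \<omega>)\<^sup>2 / real (D \<omega>))"
  define N where "N = real (card K)"
  have finI: "finite I" and finJ: "finite J" using fin by (auto simp: I_def J_def)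
  have u0: "0 \<le> u k" if "k \<in> I" for k using that w by (auto simp: I_def u_def less_imp_le)
  have Q0: "0 < Q" unfolding Q_def using fin w D by (intro sum_pos) (auto intro!: divide_pos_pos zero_less_power)
  have N0: "0 < N" using fin by (simp add: N_def card_gt_0_iff)

  have lower: "N\<^sup>2 * (real d)\<^sup>2 * Q \<le> S"
  proof -
    have row: "(\<Sum>j\<in>J. (cmod (M (\<omega>, i) j))\<^sup>2) = (\<Sum>x\<in>K. \<Sum>e<d. (cmod (f \<omega> x i e))\<^sup>2)" for \<omega> i
      unfolding J_def M_def by (simp add: sum.cartesian_product case_prod_unfold)
    have "N\<^sup>2 * (real d)\<^sup>2 * ((w \<omega>)\<^sup>2 / real (D \<omega>)) \<le>
        (\<Sum>i<D \<omega>. (w \<omega>)\<^sup>2 * (\<Sum>x\<in>K. \<Sum>e<d. (cmod (f \<omega> x i e))\<^sup>2)\<^sup>2)" if \<omega>: "\<omega> \<in> \<Omega>" for \<omega>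
    proof -
      define r where "r i = (\<Sum>x\<in>K. \<Sum>e<d. (cmod (f \<omega> x i e))\<^sup>2)" for i
      have "(\<Sum>i<D \<omega>. (cmod (f \<omega> x i e))\<^sup>2) = 1" if "x \<in> K" "e < d" for x e
      proof -
        have "complex_of_real (\<Sum>i<D \<omega>. (cmod (f \<omega> x i e))\<^sup>2) = 1"
          using ortho[OF \<omega> that that(2)] by (simp add: of_real_cmod_power2 mult.commute)
        then show ?thesis using of_real_eq_1_iff by blast
      qed
      \<comment> \<open>The \<open>N * d\<close> columns have norm one, so their total mass
        \<open>N * d\<close> is also the sum of the row masses \<open>r i\<close>.\<close>
      then have "N * d = (\<Sum>x\<in>K. \<Sum>e<d. \<Sum>i<D \<omega>. (cmod (f \<omega> x i e))\<^sup>2)"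
        by (simp add: N_def)
      also have "\<dots> = (\<Sum>x\<in>K. \<Sum>i<D \<omega>. \<Sum>e<d. (cmod (f \<omega> x i e))\<^sup>2)"
        by (intro sum.cong refl sum.swap)
      also have "\<dots> = (\<Sum>i<D \<omega>. r i)"
        unfolding r_def by (rule sum.swap)
      finally have Nd: "N * d = (\<Sum>i<D \<omega>. r i)" .
      \<comment> \<open>\<open>m\<close> is the mean of the \<open>D \<omega>\<close> row masses.
        That their variance is nonnegative is the Cauchy-Schwarz inequality needed here.\<close>
      define m where "m = N * d / D \<omega>"
      have mD: "m * D \<omega> = N * d" using D[OF \<omega>] by (simp add: m_def)
      have "0 \<le> (\<Sum>i<D \<omega>. (r i - m)\<^sup>2)" by (simp add: sum_nonneg)
      also have "\<dots> = (\<Sum>i<D \<omega>. (r i)\<^sup>2) - 2 * m * (\<Sum>i<D \<omega>. r i) + m * (m * D \<omega>)"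
        by (simp add: power2_diff sum.distrib sum_subtractf sum_distrib_left algebra_simps power2_eq_square)
      also have "\<dots> = (\<Sum>i<D \<omega>. (r i)\<^sup>2) - m * (N * d)"
        by (simp add: Nd[symmetric] mD)
      finally have "N\<^sup>2 * (real d)\<^sup>2 / D \<omega> \<le> (\<Sum>i<D \<omega>. (r i)\<^sup>2)"
        by (simp add: m_def power2_eq_square mult_ac)
      then have "(w \<omega>)\<^sup>2 * (N\<^sup>2 * (real d)\<^sup>2 / D \<omega>) \<le> (w \<omega>)\<^sup>2 * (\<Sum>i<D \<omega>. (r i)\<^sup>2)"
        by (intro mult_left_mono) auto
      then show ?thesis by (simp add: r_def sum_distrib_left mult_ac)
    qed
    then have "N\<^sup>2 * (real d)\<^sup>2 * Q \<le>
        (\<Sum>\<omega>\<in>\<Omega>. \<Sum>i<D \<omega>. (w \<omega>)\<^sup>2 * (\<Sum>x\<in>K. \<Sum>e<d. (cmod (f \<omega> x i e))\<^sup>2)\<^sup>2)"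
      unfolding Q_def sum_distrib_left by (intro sum_mono)
    also have "\<dots> = (\<Sum>k\<in>I. (u k)\<^sup>2 * (\<Sum>j\<in>J. (cmod (M k j))\<^sup>2)\<^sup>2)"
      unfolding I_def using fin by (subst sum.Sigma) (auto simp: row u_def intro!: sum.cong)
    also have "\<dots> \<le> S"
      unfolding S_def F_def by (rule gram_diagonal_le[OF finI u0])
    finally show ?thesis .
  qed

  have F_eq: "F (x, e) (y, e') = (\<Sum>\<omega>\<in>\<Omega>. of_real (w \<omega>) * (\<Sum>i<D \<omega>. cnj (f \<omega> x i e) * f \<omega> y i e'))"
    for x e y e'
    using fin sum.Sigma[of \<Omega> "\<lambda>\<omega>. {..<D \<omega>}"
        "\<lambda>\<omega> i. complex_of_real (w \<omega>) * (cnj (f \<omega> x i e) * f \<omega> y i e')"]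
    by (simp add: F_def I_def u_def M_def sum_distrib_left case_prod_unfold)

  have diag: "(\<Sum>j\<in>J. \<Sum>j'\<in>J. if fst j = fst j' then (cmod (F j j'))\<^sup>2 else 0) = N * d * P\<^sup>2"
  proof -
    have "(\<Sum>j'\<in>J. if fst j = fst j' then (cmod (F j j'))\<^sup>2 else 0) = P\<^sup>2" if j: "j \<in> J" for j
    proof -
      obtain x e where je: "j = (x, e)" and x: "x \<in> K" and e: "e < d" using j by (auto simp: J_def)
      \<comment> \<open>The columns at \<open>x\<close> are orthonormal for every \<omega>, so the
        diagonal block of \<open>F\<close> at \<open>x\<close> is \<open>P\<close> times the
        identity and each of its rows contributes the square of \<open>P\<close>.\<close>
      have F_block: "F (x, e) (x, e') = (if e = e' then of_real P else 0)" if "e' < d" for e'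
        using x e that by (simp add: F_eq ortho P_def)
      have "(\<Sum>j'\<in>J. if fst j = fst j' then (cmod (F j j'))\<^sup>2 else 0) =
          (\<Sum>y\<in>K. \<Sum>e'<d. if x = y then (cmod (F (x, e) (y, e')))\<^sup>2 else 0)"
        unfolding J_def je sum.cartesian_product by (rule sum.cong) auto
      also have "\<dots> = (\<Sum>y\<in>K. if x = y then (\<Sum>e'<d. (cmod (F (x, e) (x, e')))\<^sup>2) else 0)"
        by (intro sum.cong) auto
      also have "\<dots> = (\<Sum>e'<d. (cmod (F (x, e) (x, e')))\<^sup>2)"
        using x fin by simp
      also have "\<dots> = (\<Sum>e'<d. if e = e' then P\<^sup>2 else 0)"
        by (intro sum.cong) (auto simp: F_block)
      also have "\<dots> = P\<^sup>2" using e by simp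
      finally show ?thesis .
    qed
    then show ?thesis by (simp add: J_def N_def card_cartesian_product)
  qed

  have pos: "0 \<le> Re (\<Sum>j\<in>J. \<Sum>j'\<in>J. of_real (t (fst j) (fst j') - lam) * (cnj (b j) * F j j' * b j'))"
    for b :: "'x \<times> nat \<Rightarrow> complex"
  proof -
    \<comment> \<open>\<open>v \<omega> x\<close> is the image of the coefficients
      \<open>b (x, e)\<close> at the point \<open>x\<close>. In these vectors the form becomes
      \<open>A\<close>, which carries the weights \<open>t\<close>, minus \<open>lam\<close> times
      \<open>B\<close>, the weighted squared norms of the sums over \<open>K\<close>; these are the
      two sides that \<open>psd\<close> compares.\<close>
    define v where "v \<omega> x i = (\<Sum>e<d. f \<omega> x i e * b (x, e))" for \<omega> x i
    have norm2: "complex_of_real ((cmod (\<Sum>x\<in>K. v \<omega> x i))\<^sup>2) = (\<Sum>x\<in>K. \<Sum>y\<in>K. cnj (v \<omega> x i) * v \<omega> y i)" for \<omega> i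
      unfolding complex_norm_square by (subst mult.commute) (simp only: cnj_sum sum_product)
    have swp: "(\<Sum>i<m. \<Sum>x\<in>K. \<Sum>y\<in>K. g x y i) = (\<Sum>x\<in>K. \<Sum>y\<in>K. \<Sum>i<m. g x y i)"
      for m :: nat and g :: "'x \<Rightarrow> 'x \<Rightarrow> nat \<Rightarrow> complex"
    proof -
      have "(\<Sum>i<m. \<Sum>x\<in>K. \<Sum>y\<in>K. g x y i) = (\<Sum>x\<in>K. \<Sum>i<m. \<Sum>y\<in>K. g x y i)" by (rule sum.swap)
      also have "\<dots> = (\<Sum>x\<in>K. \<Sum>y\<in>K. \<Sum>i<m. g x y i)" by (intro sum.cong refl sum.swap)
      finally show ?thesis .
    qed
    define A where "A = (\<Sum>\<omega>\<in>\<Omega>. of_real (w \<omega>) * (\<Sum>x\<in>K. \<Sum>y\<in>K. of_real (t x y) *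
          (\<Sum>i<D \<omega>. cnj (v \<omega> x i) * v \<omega> y i)))"
    define B where "B = (\<Sum>\<omega>\<in>\<Omega>. w \<omega> * (\<Sum>i<D \<omega>. (cmod (\<Sum>x\<in>K. v \<omega> x i))\<^sup>2))"
    have B: "of_real B = (\<Sum>\<omega>\<in>\<Omega>. of_real (w \<omega>) * (\<Sum>x\<in>K. \<Sum>y\<in>K. \<Sum>i<D \<omega>. cnj (v \<omega> x i) * v \<omega> y i))"
      unfolding B_def by (simp only: of_real_sum of_real_mult norm2 swp)
    have "A - of_real lam * of_real B = (\<Sum>\<omega>\<in>\<Omega>. \<Sum>x\<in>K. \<Sum>y\<in>K.
        of_real (t x y - lam) * (of_real (w \<omega>) * (\<Sum>i<D \<omega>. cnj (v \<omega> x i) * v \<omega> y i)))"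
      unfolding A_def B by (simp add: sum_distrib_left sum_subtractf[symmetric] algebra_simps)
    also have "\<dots> = (\<Sum>x\<in>K. \<Sum>\<omega>\<in>\<Omega>. \<Sum>y\<in>K.
        of_real (t x y - lam) * (of_real (w \<omega>) * (\<Sum>i<D \<omega>. cnj (v \<omega> x i) * v \<omega> y i)))"
      by (rule sum.swap)
    also have "\<dots> = (\<Sum>x\<in>K. \<Sum>y\<in>K. \<Sum>\<omega>\<in>\<Omega>.
        of_real (t x y - lam) * (of_real (w \<omega>) * (\<Sum>i<D \<omega>. cnj (v \<omega> x i) * v \<omega> y i)))"
      by (intro sum.cong refl sum.swap)
    also have "\<dots> = (\<Sum>x\<in>K. \<Sum>y\<in>K. \<Sum>e<d. \<Sum>e'<d.
        of_real (t x y - lam) * (cnj (b (x, e)) * F (x, e) (y, e') * b (y, e')))"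
    proof (intro sum.cong refl)
      fix x y
      have "(\<Sum>i<D \<omega>. cnj (v \<omega> x i) * v \<omega> y i) =
          (\<Sum>e<d. \<Sum>e'<d. cnj (b (x, e)) * (\<Sum>i<D \<omega>. cnj (f \<omega> x i e) * f \<omega> y i e') * b (y, e'))" for \<omega>
      proof -
        have "(\<Sum>i<D \<omega>. cnj (v \<omega> x i) * v \<omega> y i) =
          (\<Sum>i<D \<omega>. \<Sum>e<d. \<Sum>e'<d. cnj (b (x, e)) * (cnj (f \<omega> x i e) * f \<omega> y i e') * b (y, e'))"
          unfolding v_def cnj_sum sum_product by (simp add: mult_ac)
        also have "\<dots> = (\<Sum>e<d. \<Sum>i<D \<omega>. \<Sum>e'<d. cnj (b (x, e)) * (cnj (f \<omega> x i e) * f \<omega> y i e') * b (y, e'))"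
          by (rule sum.swap)
        also have "\<dots> = (\<Sum>e<d. \<Sum>e'<d. \<Sum>i<D \<omega>. cnj (b (x, e)) * (cnj (f \<omega> x i e) * f \<omega> y i e') * b (y, e'))"
          by (intro sum.cong refl sum.swap)
        finally show ?thesis by (simp add: sum_distrib_left sum_distrib_right)
      qed
      then have "(\<Sum>\<omega>\<in>\<Omega>. of_real (t x y - lam) * (of_real (w \<omega>) * (\<Sum>i<D \<omega>. cnj (v \<omega> x i) * v \<omega> y i))) =
         (\<Sum>\<omega>\<in>\<Omega>. \<Sum>e<d. \<Sum>e'<d. of_real (t x y - lam) * (cnj (b (x, e)) *
            (of_real (w \<omega>) * (\<Sum>i<D \<omega>. cnj (f \<omega> x i e) * f \<omega> y i e')) * b (y, e')))"
        by (simp only: sum_distrib_left mult_ac)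
      also have "\<dots> = (\<Sum>e<d. \<Sum>\<omega>\<in>\<Omega>. \<Sum>e'<d. of_real (t x y - lam) * (cnj (b (x, e)) *
            (of_real (w \<omega>) * (\<Sum>i<D \<omega>. cnj (f \<omega> x i e) * f \<omega> y i e')) * b (y, e')))"
        by (rule sum.swap)
      also have "\<dots> = (\<Sum>e<d. \<Sum>e'<d. \<Sum>\<omega>\<in>\<Omega>. of_real (t x y - lam) * (cnj (b (x, e)) *
            (of_real (w \<omega>) * (\<Sum>i<D \<omega>. cnj (f \<omega> x i e) * f \<omega> y i e')) * b (y, e')))"
        by (intro sum.cong refl sum.swap)
      also have "\<dots> = (\<Sum>e<d. \<Sum>e'<d. of_real (t x y - lam) * (cnj (b (x, e)) * F (x, e) (y, e') * b (y, e')))"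
        unfolding F_eq by (simp only: sum_distrib_left sum_distrib_right)
      finally show "(\<Sum>\<omega>\<in>\<Omega>. of_real (t x y - lam) * (of_real (w \<omega>) * (\<Sum>i<D \<omega>. cnj (v \<omega> x i) * v \<omega> y i))) =
         (\<Sum>e<d. \<Sum>e'<d. of_real (t x y - lam) * (cnj (b (x, e)) * F (x, e) (y, e') * b (y, e')))" .
    qed
    also have "\<dots> = (\<Sum>x\<in>K. \<Sum>e<d. \<Sum>y\<in>K. \<Sum>e'<d.
        of_real (t x y - lam) * (cnj (b (x, e)) * F (x, e) (y, e') * b (y, e')))"
      by (intro sum.cong refl sum.swap)
    also have "\<dots> = (\<Sum>j\<in>J. \<Sum>j'\<in>J. of_real (t (fst j) (fst j') - lam) * (cnj (b j) * F j j' * b j'))"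
    proof -
      have "(\<Sum>j\<in>J. g j) = (\<Sum>x\<in>K. \<Sum>e<d. g (x, e))" for g :: "'x \<times> nat \<Rightarrow> complex"
        unfolding J_def sum.cartesian_product by simp
      then show ?thesis by simp
    qed
    finally have "Re (\<Sum>j\<in>J. \<Sum>j'\<in>J. of_real (t (fst j) (fst j') - lam) * (cnj (b j) * F j j' * b j')) =
        Re A - lam * B" by (metis Re_complex_of_real minus_complex.sel(1) of_real_mult)
    moreover have "lam * B \<le> Re A"
      using psd[of "\<lambda>x e. b (x, e)"] unfolding A_def B_def v_def by simp
    ultimately show ?thesis by simp
  qed
  have "0 \<le> (\<Sum>j\<in>J. \<Sum>j'\<in>J. (t (fst j) (fst j') - lam) * (cmod (F j j'))\<^sup>2)"
    using psd_pairing_nonneg[where I = I and u = u and J = J and M = M and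
        \<tau> = "\<lambda>j j'. t (fst j) (fst j') - lam"] u0 pos
    unfolding F_def by blast
  also have "\<dots> \<le> (\<Sum>j\<in>J. \<Sum>j'\<in>J. (s - lam) * (cmod (F j j'))\<^sup>2 +
      (1 - s) * (if fst j = fst j' then (cmod (F j j'))\<^sup>2 else 0))"
  proof (intro sum_mono)
    fix j j' assume "j \<in> J" "j' \<in> J"
    \<comment> \<open>At distinct points \<open>t\<close> is at most \<open>s\<close>; at equal
      points it is 1, that is \<open>s\<close> plus the excess \<open>1 - s\<close>. Only the
      diagonal blocks computed in \<open>diag\<close> carry the excess.\<close>
    then have "t (fst j) (fst j') - lam \<le> (s - lam) + (if fst j = fst j' then 1 - s else 0)"
      using t_diag t_le by (auto simp: J_def)
    then have "(t (fst j) (fst j') - lam) * (cmod (F j j'))\<^sup>2 \<le>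
        ((s - lam) + (if fst j = fst j' then 1 - s else 0)) * (cmod (F j j'))\<^sup>2"
      by (rule mult_right_mono) simp
    then show "(t (fst j) (fst j') - lam) * (cmod (F j j'))\<^sup>2 \<le> (s - lam) * (cmod (F j j'))\<^sup>2 +
      (1 - s) * (if fst j = fst j' then (cmod (F j j'))\<^sup>2 else 0)"
      by (auto simp: algebra_simps split: if_splits)
  qed
  also have "\<dots> = (s - lam) * S + (1 - s) * (N * d * P\<^sup>2)"
    unfolding S_def diag[symmetric] by (simp only: sum.distrib sum_distrib_left)
  finally have "(lam - s) * S \<le> (1 - s) * (N * d * P\<^sup>2)" by (simp add: algebra_simps)
  \<comment> \<open>Since \<open>s < lam\<close>, the lower bound for \<open>S\<close> can be
    inserted. Both sides then share the positive factor \<open>N * d\<close>, which cancels.\<close>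
  moreover have "(lam - s) * (N\<^sup>2 * (real d)\<^sup>2 * Q) \<le> (lam - s) * S"
    using lower sl by (intro mult_left_mono) auto
  ultimately have "(N * d) * (N * (d * (lam - s) * Q)) \<le> (N * d) * ((1 - s) * P\<^sup>2)"
    by (simp add: power2_eq_square mult_ac)
  then have "N * (d * (lam - s) * Q) \<le> (1 - s) * P\<^sup>2"
    using N0 d by (simp add: mult_le_cancel_left_pos)
  then have "N \<le> (1 - s) * P\<^sup>2 / (d * (lam - s) * Q)"
    using d sl Q0 by (simp add: pos_le_divide_eq)
  then show ?thesis by (simp add: N_def effective_dim_def P_def Q_def)
qed

section \<open>Adjoints, isometries and tensor products\<close>

lemma adjoint_dims [simp]:
  "dim_row (mat_adjoint A) = dim_col A" "dim_col (mat_adjoint A) = dim_row A"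
  by (simp_all add: mat_adjoint_def)

lemma adjoint_carrier [simp, intro]: "A \<in> carrier_mat m n \<Longrightarrow> mat_adjoint A \<in> carrier_mat n m"
  by auto

lemma adjoint_index [simp]:
  "i < dim_col A \<Longrightarrow> j < dim_row A \<Longrightarrow> mat_adjoint A $$ (i, j) = conjugate (A $$ (j, i))"
  by (simp add: mat_adjoint_def mat_of_rows_index)

lemma adjoint_adjoint [simp]: "mat_adjoint (mat_adjoint A) = (A :: complex mat)"
  by (rule eq_matI) auto

lemma mult_index:
  "i < dim_row A \<Longrightarrow> j < dim_col B \<Longrightarrow> dim_col A = dim_row B \<Longrightarrow>
    (A * B) $$ (i, j) = (\<Sum>k<dim_row B. A $$ (i, k) * B $$ (k, j))"
  by (simp add: scalar_prod_def lessThan_atLeast0)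

lemma mult_vec_index:
  "i < dim_row A \<Longrightarrow> dim_vec v = dim_col A \<Longrightarrow> (A *\<^sub>v v) $ i = (\<Sum>k<dim_vec v. A $$ (i, k) * v $ k)"
  by (simp add: scalar_prod_def lessThan_atLeast0)

lemma cscalar_index: "u \<bullet>c v = (\<Sum>i<dim_vec v. u $ i * cnj (v $ i))" for u v :: "complex vec"
  by (simp add: scalar_prod_def lessThan_atLeast0)

lemma adjoint_mult:
  fixes A B :: "complex mat"
  assumes "dim_col A = dim_row B"
  shows "mat_adjoint (A * B) = mat_adjoint B * mat_adjoint A"
  using assms by (intro eq_matI) (auto simp: mult_index mult.commute simp del: index_mult_mat(1))

lemma cscalar_adjoint:
  fixes A :: "complex mat"
  assumes A: "A \<in> carrier_mat m n" and v: "v \<in> carrier_vec n" and u: "u \<in> carrier_vec m"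
  shows "(A *\<^sub>v v) \<bullet>c u = v \<bullet>c (mat_adjoint A *\<^sub>v u)"
proof -
  have "(A *\<^sub>v v) \<bullet>c u = (\<Sum>i<m. \<Sum>k<n. A $$ (i, k) * v $ k * cnj (u $ i))"
    using assms by (simp add: cscalar_index mult_vec_index sum_distrib_right del: index_mult_mat_vec)
  also have "\<dots> = (\<Sum>k<n. \<Sum>i<m. A $$ (i, k) * v $ k * cnj (u $ i))" by (rule sum.swap)
  also have "\<dots> = v \<bullet>c (mat_adjoint A *\<^sub>v u)"
    using assms by (simp add: cscalar_index mult_vec_index sum_distrib_left mult_ac del: index_mult_mat_vec)
  finally show ?thesis .
qed

lemma cscalar_self: "v \<bullet>c v = complex_of_real (\<Sum>i<dim_vec v. (cmod (v $ i))\<^sup>2)"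
  unfolding cscalar_index of_real_sum complex_norm_square ..

text \<open>The length \<open>n\<close> is an argument because vectors of all lengths share one
  type, so that the summands alone do not fix the value of an empty sum.\<close>

definition sum_vec :: "nat \<Rightarrow> ('k \<Rightarrow> complex vec) \<Rightarrow> 'k set \<Rightarrow> complex vec" where
  "sum_vec n f A = vec n (\<lambda>i. \<Sum>k\<in>A. f k $ i)"

lemma sum_vec_dim [simp]: "dim_vec (sum_vec n f A) = n"
  by (simp add: sum_vec_def)

lemma sum_vec_carrier [simp, intro]: "sum_vec n f A \<in> carrier_vec n"
  by (simp add: sum_vec_def)

lemma sum_vec_index [simp]: "i < n \<Longrightarrow> sum_vec n f A $ i = (\<Sum>k\<in>A. f k $ i)"
  by (simp add: sum_vec_def)

lemma sum_vec_cong: "(\<And>k. k \<in> A \<Longrightarrow> f k = g k) \<Longrightarrow> sum_vec n f A = sum_vec n g A"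
  by (simp add: sum_vec_def cong: sum.cong)

lemma mult_sum_vec:
  assumes "B \<in> carrier_mat m n" and f: "\<And>k. k \<in> A \<Longrightarrow> f k \<in> carrier_vec n"
  shows "B *\<^sub>v sum_vec n f A = sum_vec m (\<lambda>k. B *\<^sub>v f k) A"
proof (rule eq_vecI)
  fix i assume "i < dim_vec (sum_vec m (\<lambda>k. B *\<^sub>v f k) A)"
  then have i: "i < m" by simp
  have "(B *\<^sub>v sum_vec n f A) $ i = (\<Sum>j<n. \<Sum>k\<in>A. B $$ (i, j) * f k $ j)"
    using assms i by (simp add: mult_vec_index sum_distrib_left del: index_mult_mat_vec)
  also have "\<dots> = (\<Sum>k\<in>A. \<Sum>j<n. B $$ (i, j) * f k $ j)" by (rule sum.swap)
  also have "\<dots> = (\<Sum>k\<in>A. (B *\<^sub>v f k) $ i)"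
  proof (rule sum.cong)
    fix k assume k: "k \<in> A"
    show "(\<Sum>j<n. B $$ (i, j) * f k $ j) = (B *\<^sub>v f k) $ i"
      using assms(1) i carrier_vecD[OF f[OF k]] by (auto simp: mult_vec_index simp del: index_mult_mat_vec)
  qed simp
  finally show "(B *\<^sub>v sum_vec n f A) $ i = sum_vec m (\<lambda>k. B *\<^sub>v f k) A $ i" using i by simp
qed (use assms in auto)

lemma cscalar_sum_vec_right:
  assumes "u \<in> carrier_vec n" and f: "\<And>k. k \<in> A \<Longrightarrow> f k \<in> carrier_vec n"
  shows "u \<bullet>c sum_vec n f A = (\<Sum>k\<in>A. u \<bullet>c f k)"
proof -
  have "u \<bullet>c sum_vec n f A = (\<Sum>i<n. \<Sum>k\<in>A. u $ i * cnj (f k $ i))"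
    by (simp add: cscalar_index sum_distrib_left)
  also have "\<dots> = (\<Sum>k\<in>A. \<Sum>i<n. u $ i * cnj (f k $ i))" by (rule sum.swap)
  also have "\<dots> = (\<Sum>k\<in>A. u \<bullet>c f k)"
    by (intro sum.cong) (auto simp: cscalar_index carrier_vecD[OF f])
  finally show ?thesis .
qed

lemma cscalar_sum_vec_left:
  assumes "u \<in> carrier_vec n" and f: "\<And>k. k \<in> A \<Longrightarrow> f k \<in> carrier_vec n"
  shows "sum_vec n f A \<bullet>c u = (\<Sum>k\<in>A. f k \<bullet>c u)"
proof -
  have "sum_vec n f A \<bullet>c u = (\<Sum>i<n. \<Sum>k\<in>A. f k $ i * cnj (u $ i))"
    using assms by (simp add: cscalar_index sum_distrib_right)
  also have "\<dots> = (\<Sum>k\<in>A. \<Sum>i<n. f k $ i * cnj (u $ i))" by (rule sum.swap)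
  also have "\<dots> = (\<Sum>k\<in>A. f k \<bullet>c u)"
    using assms by (simp add: cscalar_index)
  finally show ?thesis .
qed

text \<open>The ranges of the \<open>A k\<close> are mutually orthogonal, so \<eta>, the sum of the
  \<open>A k\<close> applied to their adjoints at \<xi>, is the orthogonal projection of \<xi> to
  their span. Its inner products with \<xi> and with itself both equal \<open>b\<close>, whence the
  squared norm of \<xi> - \<eta> is that of \<xi> minus \<open>b\<close>.\<close>

lemma bessel_isometries:
  fixes A :: "'k \<Rightarrow> complex mat"
  assumes "finite I" and A: "\<And>k. k \<in> I \<Longrightarrow> A k \<in> carrier_mat n (m k)"
    and iso: "\<And>k. k \<in> I \<Longrightarrow> isometric (A k)"
    and orth: "\<And>k k'. k \<in> I \<Longrightarrow> k' \<in> I \<Longrightarrow> k \<noteq> k' \<Longrightarrow> mat_adjoint (A k) * A k' = 0\<^sub>m (m k) (m k')"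
    and \<xi>: "\<xi> \<in> carrier_vec n"
  shows "(\<Sum>k\<in>I. Re ((mat_adjoint (A k) *\<^sub>v \<xi>) \<bullet>c (mat_adjoint (A k) *\<^sub>v \<xi>))) \<le> Re (\<xi> \<bullet>c \<xi>)"
proof -
  define u where "u k = mat_adjoint (A k) *\<^sub>v \<xi>" for k
  define \<eta> where "\<eta> = sum_vec n (\<lambda>k. A k *\<^sub>v u k) I"
  define b where "b = (\<Sum>k\<in>I. u k \<bullet>c u k)"
  have u: "u k \<in> carrier_vec (m k)" if "k \<in> I" for k
    unfolding u_def by (rule mult_mat_vec_carrier[OF adjoint_carrier[OF A[OF that]] \<xi>])
  have Au: "A k *\<^sub>v u k \<in> carrier_vec n" if "k \<in> I" for k
    using A[OF that] u[OF that] by auto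
  have \<eta>: "\<eta> \<in> carrier_vec n" by (simp add: \<eta>_def)
  have \<eta>\<xi>: "\<eta> \<bullet>c \<xi> = b"
  proof -
    have "\<eta> \<bullet>c \<xi> = (\<Sum>k\<in>I. (A k *\<^sub>v u k) \<bullet>c \<xi>)"
      using cscalar_sum_vec_left[OF \<xi> Au] by (simp add: \<eta>_def)
    also have "\<dots> = b"
      unfolding b_def by (intro sum.cong refl) (simp add: cscalar_adjoint[OF A u \<xi>], simp add: u_def)
    finally show ?thesis .
  qed
  \<comment> \<open>\<open>b\<close> is a sum of squared norms, hence real, so the two mixed inner
    products coincide.\<close>
  have "cnj (\<eta> \<bullet>c \<xi>) = \<xi> \<bullet>c \<eta>"
    using \<xi> \<eta> by (simp add: cscalar_index mult.commute)
  moreover have "cnj b = b"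
    unfolding b_def cnj_sum by (simp add: cscalar_self)
  ultimately have \<xi>\<eta>: "\<xi> \<bullet>c \<eta> = b" using \<eta>\<xi> by simp
  have adj_\<eta>: "mat_adjoint (A k) *\<^sub>v \<eta> = u k" if k: "k \<in> I" for k
  proof -
    have "mat_adjoint (A k) *\<^sub>v \<eta> = sum_vec (m k) (\<lambda>k'. mat_adjoint (A k) *\<^sub>v (A k' *\<^sub>v u k')) I"
      unfolding \<eta>_def using A[OF k] Au by (intro mult_sum_vec) auto
    \<comment> \<open>The isometry property preserves the summand \<open>k' = k\<close>, and
      orthogonality of the ranges kills the others.\<close>
    also have "\<dots> = sum_vec (m k) (\<lambda>k'. if k = k' then u k else 0\<^sub>v (m k)) I"
    proof (rule sum_vec_cong)
      fix k' assume k': "k' \<in> I"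
      have "mat_adjoint (A k) *\<^sub>v (A k' *\<^sub>v u k') = (mat_adjoint (A k) * A k') *\<^sub>v u k'"
        using A[OF k] A[OF k'] u[OF k'] by (intro assoc_mult_mat_vec[symmetric]) auto
      moreover have "mat_adjoint (A k) * A k = 1\<^sub>m (m k)"
        using iso[OF k] A[OF k] by (simp add: isometric_def)
      ultimately show "mat_adjoint (A k) *\<^sub>v (A k' *\<^sub>v u k') = (if k = k' then u k else 0\<^sub>v (m k))"
        using orth[OF k k'] u[OF k'] u[OF k] by auto
    qed
    also have "\<dots> = u k"
    proof (rule eq_vecI)
      fix i assume "i < dim_vec (u k)"
      then have i: "i < m k" using u[OF k] by simp
      have "(\<Sum>k'\<in>I. (if k = k' then u k else 0\<^sub>v (m k)) $ i) = (\<Sum>k'\<in>I. if k = k' then u k $ i else 0)"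
        using i by (intro sum.cong) auto
      then show "sum_vec (m k) (\<lambda>k'. if k = k' then u k else 0\<^sub>v (m k)) I $ i = u k $ i"
        using i k assms(1) by simp
    qed (use u[OF k] in auto)
    finally show ?thesis .
  qed
  have \<eta>\<eta>: "\<eta> \<bullet>c \<eta> = b"
  proof -
    have "\<eta> \<bullet>c \<eta> = (\<Sum>k\<in>I. (A k *\<^sub>v u k) \<bullet>c \<eta>)"
      using cscalar_sum_vec_left[OF \<eta> Au] by (simp add: \<eta>_def)
    also have "\<dots> = b"
      unfolding b_def by (intro sum.cong refl) (simp add: cscalar_adjoint[OF A u \<eta>] adj_\<eta>)
    finally show ?thesis .
  qed
  have "(\<xi> - \<eta>) \<bullet>c (\<xi> - \<eta>) = \<xi> \<bullet>c \<xi> - \<xi> \<bullet>c \<eta> - \<eta> \<bullet>c \<xi> + \<eta> \<bullet>c \<eta>"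
    using \<xi> \<eta> by (simp add: cscalar_index algebra_simps sum.distrib sum_subtractf)
  then have "(\<xi> - \<eta>) \<bullet>c (\<xi> - \<eta>) = \<xi> \<bullet>c \<xi> - b"
    by (simp add: \<xi>\<eta> \<eta>\<xi> \<eta>\<eta>)
  moreover have "0 \<le> Re ((\<xi> - \<eta>) \<bullet>c (\<xi> - \<eta>))"
    unfolding cscalar_self by (simp add: sum_nonneg)
  ultimately show ?thesis by (simp add: b_def u_def)
qed

text \<open>Quotient and remainder by \<open>n\<close> are inverse to \<open>a * n + b\<close>, so
  sums over Kronecker coordinates become double sums. For \<open>n = 0\<close> both sides are empty
  sums.\<close>

lemma sum_div_mod:
  fixes g :: "nat \<Rightarrow> nat \<Rightarrow> 'a :: comm_monoid_add"
  shows "(\<Sum>i<m * n. g (i div n) (i mod n)) = (\<Sum>a<m. \<Sum>b<n. g a b)"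
proof (cases "n = 0")
  case False
  then have "(\<Sum>(a, b)\<in>{..<m} \<times> {..<n}. g a b) = (\<Sum>i<m * n. g (i div n) (i mod n))"
  proof (intro sum.reindex_bij_witness[of _ "\<lambda>i. (i div n, i mod n)" "\<lambda>(a, b). a * n + b"])
    fix p assume "p \<in> {..<m} \<times> {..<n}"
    then obtain a b where p: "p = (a, b)" "a < m" "b < n" by auto
    have "a * n + b < a * n + n" using p by simp
    also have "\<dots> \<le> m * n" using p by (metis Suc_leI add.commute mult_Suc mult_le_mono1)
    finally show "(case p of (a, b) \<Rightarrow> a * n + b) \<in> {..<m * n}" using p by simp
  qed (auto simp: less_mult_imp_div_less)
  then show ?thesis by (simp add: sum.cartesian_product)
qed simp

lemma mod_less_of_less_mult: "i < m * n \<Longrightarrow> i mod n < n" for i m n :: nat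
  by (cases "n = 0") auto

section \<open>Kronecker products of vectors and matrices\<close>

lemma tensor_vec_dim [simp]: "dim_vec (tensor_vec u v) = dim_vec u * dim_vec v"
  by (simp add: tensor_vec_def)

lemma tensor_vec_carrier [intro]:
  "u \<in> carrier_vec m \<Longrightarrow> v \<in> carrier_vec n \<Longrightarrow> tensor_vec u v \<in> carrier_vec (m * n)"
  by (auto simp: tensor_vec_def)

lemma tensor_mat_carrier [intro]:
  "A \<in> carrier_mat m n \<Longrightarrow> B \<in> carrier_mat m' n' \<Longrightarrow> tensor_mat A B \<in> carrier_mat (m * m') (n * n')"
  by (auto simp: tensor_mat_def)

lemma cscalar_tensor_vec:
  assumes "u \<in> carrier_vec m" "u' \<in> carrier_vec m" "v \<in> carrier_vec n" "v' \<in> carrier_vec n"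
  shows "tensor_vec u v \<bullet>c tensor_vec u' v' = (u \<bullet>c u') * (v \<bullet>c v')"
proof -
  have "tensor_vec u v \<bullet>c tensor_vec u' v' =
      (\<Sum>i<m * n. (u $ (i div n) * v $ (i mod n)) * cnj (u' $ (i div n) * v' $ (i mod n)))"
    using assms by (simp add: cscalar_index tensor_vec_def)
  also have "\<dots> = (\<Sum>a<m. \<Sum>b<n. (u $ a * v $ b) * cnj (u' $ a * v' $ b))"
    by (rule sum_div_mod)
  also have "\<dots> = (u \<bullet>c u') * (v \<bullet>c v')"
    using assms by (simp add: cscalar_index sum_product mult_ac)
  finally show ?thesis .
qed

lemma tensor_mat_mult_vec:
  assumes A: "A \<in> carrier_mat m n" and B: "B \<in> carrier_mat m' n'"
    and u: "u \<in> carrier_vec n" and v: "v \<in> carrier_vec n'"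
  shows "tensor_mat A B *\<^sub>v tensor_vec u v = tensor_vec (A *\<^sub>v u) (B *\<^sub>v v)"
proof (rule eq_vecI)
  fix i assume "i < dim_vec (tensor_vec (A *\<^sub>v u) (B *\<^sub>v v))"
  then have i: "i < m * m'" using A B by simp
  note i' = less_mult_imp_div_less[OF i] mod_less_of_less_mult[OF i]
  have "(tensor_mat A B *\<^sub>v tensor_vec u v) $ i =
      (\<Sum>k<n * n'. (A $$ (i div m', k div n') * B $$ (i mod m', k mod n')) * (u $ (k div n') * v $ (k mod n')))"
    using assms i by (simp add: mult_vec_index tensor_mat_def tensor_vec_def del: index_mult_mat_vec)
  also have "\<dots> = (\<Sum>a<n. \<Sum>b<n'. (A $$ (i div m', a) * B $$ (i mod m', b)) * (u $ a * v $ b))"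
    by (rule sum_div_mod)
  also have "\<dots> = (A *\<^sub>v u) $ (i div m') * (B *\<^sub>v v) $ (i mod m')"
    using assms i' by (simp add: mult_vec_index sum_product mult_ac del: index_mult_mat_vec)
  also have "\<dots> = tensor_vec (A *\<^sub>v u) (B *\<^sub>v v) $ i"
    using A B i by (simp add: tensor_vec_def del: index_mult_mat_vec)
  finally show "(tensor_mat A B *\<^sub>v tensor_vec u v) $ i = tensor_vec (A *\<^sub>v u) (B *\<^sub>v v) $ i" .
qed (use A B in \<open>auto simp: tensor_mat_def\<close>)

lemma tensor_mat_mult:
  assumes A: "A \<in> carrier_mat m n" and A': "A' \<in> carrier_mat n q"
    and B: "B \<in> carrier_mat m' n'" and B': "B' \<in> carrier_mat n' q'"
  shows "tensor_mat A B * tensor_mat A' B' = tensor_mat (A * A') (B * B')"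
proof (rule eq_matI)
  fix i j assume "i < dim_row (tensor_mat (A * A') (B * B'))" "j < dim_col (tensor_mat (A * A') (B * B'))"
  then have i: "i < m * m'" and j: "j < q * q'" using assms by (auto simp: tensor_mat_def)
  note ij = less_mult_imp_div_less[OF i] mod_less_of_less_mult[OF i]
    less_mult_imp_div_less[OF j] mod_less_of_less_mult[OF j]
  have "(tensor_mat A B * tensor_mat A' B') $$ (i, j) = (\<Sum>k<n * n'.
      (A $$ (i div m', k div n') * B $$ (i mod m', k mod n')) *
      (A' $$ (k div n', j div q') * B' $$ (k mod n', j mod q')))"
    using assms i j by (simp add: mult_index tensor_mat_def del: index_mult_mat(1))
  also have "\<dots> = (\<Sum>a<n. \<Sum>b<n'. (A $$ (i div m', a) * B $$ (i mod m', b)) *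
      (A' $$ (a, j div q') * B' $$ (b, j mod q')))"
    by (rule sum_div_mod)
  also have "\<dots> = (A * A') $$ (i div m', j div q') * (B * B') $$ (i mod m', j mod q')"
    using assms ij by (simp add: mult_index sum_product mult_ac del: index_mult_mat(1))
  also have "\<dots> = tensor_mat (A * A') (B * B') $$ (i, j)"
    using assms i j by (simp add: tensor_mat_def del: index_mult_mat(1))
  finally show "(tensor_mat A B * tensor_mat A' B') $$ (i, j) = tensor_mat (A * A') (B * B') $$ (i, j)" .
qed (use assms in \<open>auto simp: tensor_mat_def\<close>)

lemma tensor_mat_one: "tensor_mat (1\<^sub>m m) (1\<^sub>m n) = 1\<^sub>m (m * n)"
proof (rule eq_matI)
  fix i j assume ij: "i < dim_row (1\<^sub>m (m * n) :: complex mat)" "j < dim_col (1\<^sub>m (m * n) :: complex mat)"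
  have "i = j \<longleftrightarrow> i div n = j div n \<and> i mod n = j mod n"
    by (metis div_mult_mod_eq)
  then show "tensor_mat (1\<^sub>m m) (1\<^sub>m n) $$ (i, j) = 1\<^sub>m (m * n) $$ (i, j)"
    using ij by (auto simp: tensor_mat_def less_mult_imp_div_less mod_less_of_less_mult)
qed (auto simp: tensor_mat_def)

lemma adjoint_tensor_mat: "mat_adjoint (tensor_mat A B) = tensor_mat (mat_adjoint A) (mat_adjoint B)"
  by (rule eq_matI)
    (auto simp: tensor_mat_def less_mult_imp_div_less mod_less_of_less_mult)

section \<open>Intertwiners and Schur's lemma\<close>

text \<open>Independent subsets of \<open>N\<close> are independent in the whole space, so their
  size is at most \<open>dim\<close>. One of greatest size is maximal among the independent subsets
  of \<open>N\<close>, and therefore a finite generating set.\<close>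

lemma (in vectorspace) subspace_fin_dim:
  assumes fd: "fin_dim" and N: "subspace K N V"
  shows "vectorspace.fin_dim K (vs N)"
proof -
  interpret N: vectorspace K "vs N" using N by (rule subspace_is_vs)
  have NV: "N \<subseteq> carrier V" using N by (auto simp: subspace_def submodule_def)
  have li: "N.lin_dep S = lin_dep S" if "S \<subseteq> N" for S
    using span_li_not_depend(2)[of S N] that N by (auto simp: subspace_def)
  define P where "P k \<longleftrightarrow> (\<exists>S\<subseteq>N. lin_indpt S \<and> card S = k)" for k
  have "P 0" unfolding P_def
    by (intro exI[of _ "{}"]) (auto simp: lin_dep_def)
  moreover have bound: "\<forall>k. P k \<longrightarrow> k \<le> dim"
    using li_le_dim(2)[OF fd] NV by (auto simp: P_def)
  ultimately have "P (Greatest P)" by (metis GreatestI_nat)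
  then obtain S where S: "S \<subseteq> N" "lin_indpt S" "card S = Greatest P"
    by (auto simp: P_def)
  have "maximal S (\<lambda>S. S \<subseteq> carrier (vs N) \<and> \<not> N.lin_dep S)"
    unfolding maximal_def
  proof (intro conjI allI impI)
    show "S \<subseteq> carrier (vs N)" "\<not> N.lin_dep S" using S li by auto
    fix B assume B: "S \<subseteq> B \<and> B \<subseteq> carrier (vs N) \<and> \<not> N.lin_dep B"
    then have BN: "B \<subseteq> N" "lin_indpt B" using li by auto
    have "finite B" using BN NV by (intro fin_dim_li_fin[OF fd]) auto
    moreover have "card B \<le> card S"
      using BN bound S(3) Greatest_le_nat[of P "card B" dim] by (auto simp: P_def)
    ultimately show "B = S" using B by (metis card_seteq)
  qed
  then have "N.span S = carrier (vs N)" by (rule N.max_li_is_gen)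
  moreover have "finite S" using S NV by (intro fin_dim_li_fin[OF fd]) auto
  ultimately show ?thesis unfolding N.fin_dim_def using S(1) by (intro exI[of _ S]) auto
qed

text \<open>The map \<open>?f\<close> fills a matrix row by row from a vector of length
  \<open>nr * nc\<close>. It is linear and onto, and finite dimension passes to the image.\<close>

lemma matrix_fin_dim: "vectorspace.fin_dim class_ring (module_mat TYPE('a :: field) nr nc)"
proof -
  let ?f = "\<lambda>v :: 'a vec. mat nr nc (\<lambda>(i, j). v $ (i * nc + j))"
  have idx: "i * nc + j < nr * nc" if "i < nr" "j < nc" for i j
  proof -
    have "i * nc + j < Suc i * nc" using that by simp
    also have "\<dots> \<le> nr * nc" using that by (intro mult_le_mono1) simp
    finally show ?thesis .
  qed
  interpret vec_space "TYPE('a)" "nr * nc" .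
  have "linear_map class_ring (module_vec TYPE('a) (nr * nc)) (module_mat TYPE('a) nr nc) ?f"
    unfolding linear_map_def mod_hom_def mod_hom_axioms_def module_hom_def
    using vec_vs[of "nr * nc", where ?'a = 'a] matrix_vs[of nr nc, where ?'a = 'a]
    by (auto simp: vectorspace_def module_vec_simps module_mat_simps idx intro!: eq_matI)
  moreover have "?f ` carrier_vec (nr * nc) = carrier_mat nr nc"
  proof (intro equalityI subsetI)
    fix A :: "'a mat" assume A: "A \<in> carrier_mat nr nc"
    have "?f (vec (nr * nc) (\<lambda>k. A $$ (k div nc, k mod nc))) = A"
      using A by (intro eq_matI) (auto simp: idx)
    from this[symmetric] show "A \<in> ?f ` carrier_vec (nr * nc)" by (rule image_eqI) simp
  qed auto
  ultimately show ?thesis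
    using linear_map.surj_fin_dim[of class_ring "module_vec TYPE('a) (nr * nc)" "module_mat TYPE('a) nr nc" ?f] fin_dim
    by (simp add: module_vec_simps module_mat_simps)
qed

text \<open>The intertwining equations are linear in the matrix. This is what makes
  \<open>hom_dim\<close> the dimension of a vector space.\<close>

lemma intertwiners_subspace:
  assumes U: "\<And>g. g \<in> carrier G \<Longrightarrow> rmat U g \<in> carrier_mat (rdim U) (rdim U)"
    and V: "\<And>g. g \<in> carrier G \<Longrightarrow> rmat V g \<in> carrier_mat (rdim V) (rdim V)"
  shows "subspace class_ring (intertwiners G U V) (module_mat TYPE(complex) (rdim V) (rdim U))"
  unfolding subspace_def
proof (intro conjI submodule.intro)
  show "vectorspace class_ring (module_mat TYPE(complex) (rdim V) (rdim U))" by (rule matrix_vs)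
  then show "module class_ring (module_mat TYPE(complex) (rdim V) (rdim U))" by (simp add: vectorspace_def)
next
  fix S T assume ST: "S \<in> intertwiners G U V" "T \<in> intertwiners G U V"
  show "S \<oplus>\<^bsub>module_mat TYPE(complex) (rdim V) (rdim U)\<^esub> T \<in> intertwiners G U V"
    using ST add_mult_distrib_mat[OF _ _ U] mult_add_distrib_mat[OF V]
    by (auto simp: intertwiners_def module_mat_simps)
next
  show "\<zero>\<^bsub>module_mat TYPE(complex) (rdim V) (rdim U)\<^esub> \<in> intertwiners G U V"
    using left_mult_zero_mat[OF U] right_mult_zero_mat[OF V]
    by (auto simp: intertwiners_def module_mat_simps)
next
  fix z T assume T: "T \<in> intertwiners G U V"
  show "z \<odot>\<^bsub>module_mat TYPE(complex) (rdim V) (rdim U)\<^esub> T \<in> intertwiners G U V"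
    using T mult_smult_assoc_mat[OF _ U] mult_smult_distrib[OF V]
    by (auto simp: intertwiners_def module_mat_simps)
qed (auto simp: intertwiners_def module_mat_simps)

text \<open>A nonzero vector forms an independent set, and in a space of dimension one such a
  singleton is a basis. Multiplicity one enters the argument in this form.\<close>

lemma hom_dim_one_multiple:
  assumes "\<And>g. g \<in> carrier G \<Longrightarrow> rmat U g \<in> carrier_mat (rdim U) (rdim U)"
    and "\<And>g. g \<in> carrier G \<Longrightarrow> rmat V g \<in> carrier_mat (rdim V) (rdim V)"
    and "hom_dim G U V = 1"
    and A: "A \<in> intertwiners G U V" "A \<noteq> 0\<^sub>m (rdim V) (rdim U)"
    and B: "B \<in> intertwiners G U V"
  shows "\<exists>z. B = z \<cdot>\<^sub>m A"
proof -
  let ?M = "module_mat TYPE(complex) (rdim V) (rdim U)"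
  interpret M: vectorspace class_ring ?M by (rule matrix_vs)
  note sub = intertwiners_subspace[OF assms(1,2)]
  interpret N: vectorspace class_ring "M.vs (intertwiners G U V)"
    using sub by (rule M.subspace_is_vs)
  \<comment> \<open>An independent set of \<open>dim\<close> elements is known to be a basis only in
    a finite-dimensional space, so this has to be settled before \<open>hom_dim\<close> can be
    exploited.\<close>
  have "N.fin_dim" using matrix_fin_dim sub by (rule M.subspace_fin_dim)
  moreover have "N.dim = 1" using assms(3) by (simp add: hom_dim_def)
  moreover have "N.lin_indpt {A}"
    using N.lin_dep_iff_in_span[of "{}" A] A N.span_empty N.finite_lin_indpt2[of "{}"]
    by (simp add: module_mat_simps)
  ultimately have "N.basis {A}" using A by (intro N.dim_li_is_basis) auto
  then have "N.span {A} = intertwiners G U V" by (simp add: N.basis_def)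
  then have "B \<in> N.span {A}" using B by simp
  then obtain a where "N.lincomb a {A} = B" using N.finite_in_span[of "{A}" B] A by auto
  moreover have "A \<in> carrier_mat (rdim V) (rdim U)" using A by (simp add: intertwiners_def)
  then have "N.lincomb a {A} = a A \<cdot>\<^sub>m A"
    using A N.lincomb_insert[where S = "{}" and v = A and a = a]
      right_add_zero_mat[of "a A \<cdot>\<^sub>m A" "rdim V" "rdim U"]
    by (simp add: N.lincomb_def module_mat_simps)
  ultimately show ?thesis by blast
qed

section \<open>Unitary representations and their intertwiners\<close>

lemma unitary_rep_carrier:
  "unitary_rep G V \<Longrightarrow> g \<in> carrier G \<Longrightarrow> rmat V g \<in> carrier_mat (rdim V) (rdim V)"
  by (simp add: unitary_rep_def)

lemma unitary_rep_adjoint_mult: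
  "unitary_rep G V \<Longrightarrow> g \<in> carrier G \<Longrightarrow> mat_adjoint (rmat V g) * rmat V g = 1\<^sub>m (rdim V)"
  using unitary_rep_carrier[of G V g] by (auto simp: unitary_rep_def isometric_def)

lemma unitary_rep_mult_adjoint:
  assumes "unitary_rep G V" "g \<in> carrier G"
  shows "rmat V g * mat_adjoint (rmat V g) = 1\<^sub>m (rdim V)"
  using unitary_rep_carrier[OF assms] unitary_rep_adjoint_mult[OF assms]
  by (intro mat_mult_left_right_inverse[of "mat_adjoint (rmat V g)"]) auto

lemma intertwinersD:
  "T \<in> intertwiners G U V \<Longrightarrow> T \<in> carrier_mat (rdim V) (rdim U)"
  "T \<in> intertwiners G U V \<Longrightarrow> g \<in> carrier G \<Longrightarrow> T * rmat U g = rmat V g * T"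
  by (auto simp: intertwiners_def)

text \<open>Taking adjoints of the intertwining equation gives \<open>comm\<close>, the same
  equation for the adjoint of \<open>T\<close> and the adjoint group matrices. Multiplying by
  \<open>?U\<close> on the left and by \<open>?V\<close> on the right cancels those matrices by
  unitarity.\<close>

lemma adjoint_intertwiner:
  assumes U: "unitary_rep G U" and V: "unitary_rep G V" and T: "T \<in> intertwiners G U V"
  shows "mat_adjoint T \<in> intertwiners G V U"
  unfolding intertwiners_def
proof (intro CollectI conjI ballI)
  show "mat_adjoint T \<in> carrier_mat (rdim U) (rdim V)"
    using intertwinersD(1)[OF T] by (rule adjoint_carrier)
  fix g assume g: "g \<in> carrier G"
  let ?T = "mat_adjoint T" and ?U = "rmat U g" and ?V = "rmat V g"
  note Uc = unitary_rep_carrier[OF U g] and Vc = unitary_rep_carrier[OF V g]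
  note aU = adjoint_carrier[OF Uc] and aV = adjoint_carrier[OF Vc]
    and aT = adjoint_carrier[OF intertwinersD(1)[OF T]]
  have comm: "mat_adjoint ?U * ?T = ?T * mat_adjoint ?V"
    using arg_cong[OF intertwinersD(2)[OF T g], of mat_adjoint]
      adjoint_mult[of T ?U] adjoint_mult[of ?V T] carrier_matD[OF intertwinersD(1)[OF T]]
      carrier_matD[OF unitary_rep_carrier[OF U g]] carrier_matD[OF unitary_rep_carrier[OF V g]]
    by simp
  have "?T * ?V = (?U * mat_adjoint ?U) * (?T * ?V)"
    using unitary_rep_mult_adjoint[OF U g] left_mult_one_mat[OF mult_carrier_mat[OF aT Vc]] by simp
  also have "\<dots> = ?U * (mat_adjoint ?U * (?T * ?V))"
    by (rule assoc_mult_mat[OF Uc aU mult_carrier_mat[OF aT Vc]])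
  also have "mat_adjoint ?U * (?T * ?V) = (mat_adjoint ?U * ?T) * ?V"
    by (rule assoc_mult_mat[OF aU aT Vc, symmetric])
  also have "\<dots> = ?T * (mat_adjoint ?V * ?V)"
    unfolding comm by (rule assoc_mult_mat[OF aT aV Vc])
  also have "\<dots> = ?T"
    using unitary_rep_adjoint_mult[OF V g] right_mult_one_mat[OF aT] by simp
  finally show "?T * ?V = ?U * ?T" .
qed

lemma intertwiner_mult:
  assumes U: "\<And>g. g \<in> carrier G \<Longrightarrow> rmat U g \<in> carrier_mat (rdim U) (rdim U)"
    and V: "\<And>g. g \<in> carrier G \<Longrightarrow> rmat V g \<in> carrier_mat (rdim V) (rdim V)"
    and W: "\<And>g. g \<in> carrier G \<Longrightarrow> rmat W g \<in> carrier_mat (rdim W) (rdim W)"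
    and T: "T \<in> intertwiners G U V" and S: "S \<in> intertwiners G V W"
  shows "S * T \<in> intertwiners G U W"
  unfolding intertwiners_def
proof (intro CollectI conjI ballI)
  note ST = intertwinersD(1)[OF S] intertwinersD(1)[OF T]
  show "S * T \<in> carrier_mat (rdim W) (rdim U)" using ST by (rule mult_carrier_mat)
  fix g assume g: "g \<in> carrier G"
  show "S * T * rmat U g = rmat W g * (S * T)"
    using assoc_mult_mat[OF ST U[OF g]] assoc_mult_mat[OF ST(1) V[OF g] ST(2)]
      assoc_mult_mat[OF W[OF g] ST] intertwinersD(2)[OF S g] intertwinersD(2)[OF T g]
    by simp
qed

text \<open>If there were more columns than rows, padding with zero rows would give a singular
  square matrix, and a nonzero vector in its kernel would be killed by \<open>A\<close> as
  well.\<close>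

lemma injective_matrix_dims:
  fixes A :: "complex mat"
  assumes A: "A \<in> carrier_mat m n"
    and inj: "\<And>v. v \<in> carrier_vec n \<Longrightarrow> A *\<^sub>v v = 0\<^sub>v m \<Longrightarrow> v = 0\<^sub>v n"
  shows "n \<le> m"
proof (rule ccontr)
  assume "\<not> n \<le> m"
  then have mn: "m < n" by simp
  define B where "B = mat n n (\<lambda>(i, j). if i < m then A $$ (i, j) else 0)"
  have B: "B \<in> carrier_mat n n" by (simp add: B_def)
  \<comment> \<open>Row \<open>m\<close> exists because \<open>m < n\<close> and is the first
    padding row. Writing its zero vector explicitly gives the shape that \<open>det_row_0\<close>
    matches.\<close>
  have "B = mat\<^sub>r n n (\<lambda>i. if i = m then 0\<^sub>v n else row B i)"
    using mn by (intro eq_matI) (auto simp: B_def)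
  moreover have "det \<dots> = 0" using B mn by (intro det_row_0) auto
  ultimately have "det B = 0" by simp
  then obtain v where v: "v \<in> carrier_vec n" "v \<noteq> 0\<^sub>v n" "B *\<^sub>v v = 0\<^sub>v n"
    using det_0_iff_vec_prod_zero_field[OF B] by blast
  have "A *\<^sub>v v = 0\<^sub>v m"
  proof (rule eq_vecI)
    fix i assume "i < dim_vec (0\<^sub>v m :: complex vec)"
    then have i: "i < m" by simp
    have "row B i = row A i"
      using i mn A by (intro eq_vecI) (auto simp: B_def)
    then have "(A *\<^sub>v v) $ i = (B *\<^sub>v v) $ i" using i mn A B by simp
    then show "(A *\<^sub>v v) $ i = 0\<^sub>v m $ i" using v(3) i mn by simp
  qed (use A in auto)
  then show False using inj v by blast
qed

lemma mat_eq_of_mult_vec_eq: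
  fixes A B :: "complex mat"
  assumes A: "A \<in> carrier_mat m n" and B: "B \<in> carrier_mat m n"
    and eq: "\<And>v. v \<in> carrier_vec n \<Longrightarrow> A *\<^sub>v v = B *\<^sub>v v"
  shows "A = B"
proof (rule eq_matI)
  fix i j assume ij: "i < dim_row B" "j < dim_col B"
  have "(A *\<^sub>v unit_vec n j) $ i = A $$ (i, j)" "(B *\<^sub>v unit_vec n j) $ i = B $$ (i, j)"
    using A B ij by auto
  then show "A $$ (i, j) = B $$ (i, j)" using eq[of "unit_vec n j"] by simp
qed (use A B in auto)

text \<open>The kernel of \<open>T\<close> is an invariant subspace, so irreducibility leaves only
  the zero space or the full space, and the latter would make \<open>T\<close> zero.\<close>

lemma irreducible_kernel:
  assumes U: "\<And>g. g \<in> carrier G \<Longrightarrow> rmat U g \<in> carrier_mat (rdim U) (rdim U)"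
    and V: "\<And>g. g \<in> carrier G \<Longrightarrow> rmat V g \<in> carrier_mat (rdim V) (rdim V)"
    and irr: "irreducible_rep G U" and T: "T \<in> intertwiners G U V"
    and nz: "T \<noteq> 0\<^sub>m (rdim V) (rdim U)"
    and v: "v \<in> carrier_vec (rdim U)" "T *\<^sub>v v = 0\<^sub>v (rdim V)"
  shows "v = 0\<^sub>v (rdim U)"
proof -
  define S where "S = {v \<in> carrier_vec (rdim U). T *\<^sub>v v = 0\<^sub>v (rdim V)}"
  note Tc = intertwinersD(1)[OF T]
  have "VectorSpace.subspace class_ring S (module_vec TYPE(complex) (rdim U))"
    unfolding VectorSpace.subspace_def
  proof (intro conjI submodule.intro)
    show "vectorspace class_ring (module_vec TYPE(complex) (rdim U))" by (rule vec_vs)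
    then show "Module.module class_ring (module_vec TYPE(complex) (rdim U))" by (simp add: vectorspace_def)
  qed (use Tc in \<open>auto simp: S_def module_vec_simps mult_add_distrib_mat_vec[OF Tc] mult_mat_vec[OF Tc]\<close>)
  moreover have "rmat U g *\<^sub>v v \<in> S" if g: "g \<in> carrier G" and v: "v \<in> S" for g v
  proof -
    have vc: "v \<in> carrier_vec (rdim U)" and Tv: "T *\<^sub>v v = 0\<^sub>v (rdim V)" using v by (auto simp: S_def)
    have "T *\<^sub>v (rmat U g *\<^sub>v v) = (T * rmat U g) *\<^sub>v v"
      using Tc U[OF g] vc by (rule assoc_mult_mat_vec[symmetric])
    also have "\<dots> = rmat V g *\<^sub>v (T *\<^sub>v v)"
      unfolding intertwinersD(2)[OF T g] using V[OF g] Tc vc by (rule assoc_mult_mat_vec)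
    also have "\<dots> = 0\<^sub>v (rdim V)" using V[OF g] by (auto simp: Tv)
    finally show ?thesis using mult_mat_vec_carrier[OF U[OF g] vc] by (simp add: S_def)
  qed
  ultimately have "S = {0\<^sub>v (rdim U)} \<or> S = carrier_vec (rdim U)"
    using irr unfolding irreducible_rep_def by blast
  moreover have "S \<noteq> carrier_vec (rdim U)"
  proof
    assume S: "S = carrier_vec (rdim U)"
    have "T *\<^sub>v v = 0\<^sub>m (rdim V) (rdim U) *\<^sub>v v" if "v \<in> carrier_vec (rdim U)" for v
    proof -
      have "0\<^sub>m (rdim V) (rdim U) *\<^sub>v v = 0\<^sub>v (rdim V)" using that by (intro eq_vecI) auto
      then show ?thesis using that S by (auto simp: S_def)
    qed
    then show False using mat_eq_of_mult_vec_eq[OF Tc zero_carrier_mat] nz by blast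
  qed
  ultimately show ?thesis using v by (auto simp: S_def)
qed

text \<open>A nonzero \<open>T\<close> has trivial kernel, and so has its adjoint, which is a
  nonzero intertwiner in the other direction. Hence the dimensions agree, \<open>T\<close> is square
  with nonzero determinant, and it would be an equivalence.\<close>

lemma schur_intertwiner_zero:
  assumes U: "unitary_rep G U" "irreducible_rep G U" and V: "unitary_rep G V" "irreducible_rep G V"
    and neq: "\<not> equivalent_rep G U V" and T: "T \<in> intertwiners G U V"
  shows "T = 0\<^sub>m (rdim V) (rdim U)"
proof (rule ccontr)
  assume nz: "T \<noteq> 0\<^sub>m (rdim V) (rdim U)"
  note Tc = intertwinersD(1)[OF T]
  note T' = adjoint_intertwiner[OF U(1) V(1) T]
  have nz': "mat_adjoint T \<noteq> 0\<^sub>m (rdim U) (rdim V)"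
  proof
    assume "mat_adjoint T = 0\<^sub>m (rdim U) (rdim V)"
    then have "mat_adjoint (mat_adjoint T) = mat_adjoint (0\<^sub>m (rdim U) (rdim V))" by simp
    also have "\<dots> = 0\<^sub>m (rdim V) (rdim U)" by (rule eq_matI) auto
    finally show False using nz by simp
  qed
  have ker: "v = 0\<^sub>v (rdim U)" if "v \<in> carrier_vec (rdim U)" "T *\<^sub>v v = 0\<^sub>v (rdim V)" for v
    using irreducible_kernel[OF unitary_rep_carrier[OF U(1)] unitary_rep_carrier[OF V(1)] U(2) T nz that] .
  have "rdim U \<le> rdim V" using Tc ker by (rule injective_matrix_dims)
  moreover have "rdim V \<le> rdim U"
    using intertwinersD(1)[OF T'] irreducible_kernel[OF unitary_rep_carrier[OF V(1)]
        unitary_rep_carrier[OF U(1)] V(2) T' nz'] by (rule injective_matrix_dims)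
  ultimately have dim: "rdim V = rdim U" by simp
  then have Tsq: "T \<in> carrier_mat (rdim U) (rdim U)" using Tc by simp
  then have "det T \<noteq> 0" using det_0_iff_vec_prod_zero_field[OF Tsq] ker dim by auto
  \<comment> \<open>A unit of the ring of square matrices has a two-sided inverse, as
    \<open>equivalent_rep\<close> demands.\<close>
  then have "T \<in> Units (ring_mat TYPE(complex) (rdim U) ())"
    using Tsq by (intro det_non_zero_imp_unit)
  then have "invertible_mat T"
    using Tsq by (auto simp: Units_def ring_mat_def invertible_mat_def inverts_mat_def)
  then show False using neq T by (auto simp: equivalent_rep_def)
qed

lemma tensor_rep_unitary:
  assumes U: "unitary_rep G U" and V: "unitary_rep G V"
  shows "unitary_rep G (tensor_rep U V)"
  unfolding unitary_rep_def
proof (intro conjI ballI)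
  fix g assume g: "g \<in> carrier G"
  note Ug = unitary_rep_carrier[OF U g] and Vg = unitary_rep_carrier[OF V g]
  show c: "rmat (tensor_rep U V) g \<in> carrier_mat (rdim (tensor_rep U V)) (rdim (tensor_rep U V))"
    using Ug Vg by (auto simp: tensor_rep_def)
  show "isometric (rmat (tensor_rep U V) g)"
    using c unitary_rep_adjoint_mult[OF U g] unitary_rep_adjoint_mult[OF V g]
      tensor_mat_mult[OF adjoint_carrier[OF Ug] Ug adjoint_carrier[OF Vg] Vg]
    by (simp add: isometric_def adjoint_tensor_mat tensor_rep_def tensor_mat_one)
  fix h assume h: "h \<in> carrier G"
  show "rmat (tensor_rep U V) (g \<otimes>\<^bsub>G\<^esub> h) = rmat (tensor_rep U V) g * rmat (tensor_rep U V) h"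
    using tensor_mat_mult[OF Ug unitary_rep_carrier[OF U h] Vg unitary_rep_carrier[OF V h]] U V g h
    by (simp add: tensor_rep_def unitary_rep_def)
qed (use U V in \<open>simp add: tensor_rep_def unitary_rep_def tensor_mat_one\<close>)

section \<open>Compression of tensor products\<close>

lemma isometric_mult:
  assumes A: "A \<in> carrier_mat m n" "isometric A" and B: "B \<in> carrier_mat n k" "isometric B"
  shows "isometric (A * B)"
proof -
  have "mat_adjoint (A * B) * (A * B) = (mat_adjoint B * mat_adjoint A) * (A * B)"
    using A B by (simp add: adjoint_mult)
  also have "\<dots> = mat_adjoint B * (mat_adjoint A * (A * B))"
    by (rule assoc_mult_mat[OF adjoint_carrier[OF B(1)] adjoint_carrier[OF A(1)] mult_carrier_mat[OF A(1) B(1)]])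
  also have "mat_adjoint A * (A * B) = (mat_adjoint A * A) * B"
    by (rule assoc_mult_mat[OF adjoint_carrier[OF A(1)] A(1) B(1), symmetric])
  also have "\<dots> = B" using A B by (simp add: isometric_def)
  finally show ?thesis using A B by (simp add: isometric_def)
qed

lemma isometric_cols_orthonormal:
  assumes A: "A \<in> carrier_mat m n" "isometric A" and e: "e < n" "e' < n"
  shows "(\<Sum>i<m. cnj (A $$ (i, e)) * A $$ (i, e')) = (if e = e' then 1 else 0)"
proof -
  have "(mat_adjoint A * A) $$ (e, e') = (\<Sum>i<m. cnj (A $$ (i, e)) * A $$ (i, e'))"
    using A e by (simp add: mult_index del: index_mult_mat(1))
  moreover have "mat_adjoint A * A = 1\<^sub>m n" using A by (simp add: isometric_def)
  ultimately show ?thesis using e by (metis index_one_mat(1))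
qed

text \<open>The definite description is justified by injectivity of the isometry \<open>B\<close>:
  the adjoint of \<open>B\<close> strips it from the equation at the basis vector 0, which exists
  because \<open>n\<close> is positive, and coordinate 0 reveals the scalar.\<close>

lemma schur_scalar_eq:
  assumes B: "B \<in> carrier_mat m n" "isometric B" "0 < n" and A: "dim_col A = n"
    and z: "\<And>u. u \<in> carrier_vec n \<Longrightarrow> mat_adjoint C *\<^sub>v tensor_vec l (A *\<^sub>v u) = z \<cdot>\<^sub>v (B *\<^sub>v u)"
  shows "schur_scalar C l A B = z"
  unfolding schur_scalar_def
proof (rule the_equality)
  show "\<forall>u\<in>carrier_vec (dim_col A). mat_adjoint C *\<^sub>v tensor_vec l (A *\<^sub>v u) = z \<cdot>\<^sub>v (B *\<^sub>v u)"
    using z A by simp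
  fix z' assume z': "\<forall>u\<in>carrier_vec (dim_col A). mat_adjoint C *\<^sub>v tensor_vec l (A *\<^sub>v u) = z' \<cdot>\<^sub>v (B *\<^sub>v u)"
  let ?u = "unit_vec n 0 :: complex vec"
  have Bu: "B *\<^sub>v ?u \<in> carrier_vec m" using B by auto
  have "mat_adjoint B *\<^sub>v (B *\<^sub>v ?u) = (mat_adjoint B * B) *\<^sub>v ?u"
    using assoc_mult_mat_vec[OF adjoint_carrier[OF B(1)] B(1), of ?u] by simp
  then have inv: "mat_adjoint B *\<^sub>v (B *\<^sub>v ?u) = ?u" using B by (simp add: isometric_def)
  have "z' \<cdot>\<^sub>v (B *\<^sub>v ?u) = z \<cdot>\<^sub>v (B *\<^sub>v ?u)" using z z' A by simp
  then have "mat_adjoint B *\<^sub>v (z' \<cdot>\<^sub>v (B *\<^sub>v ?u)) = mat_adjoint B *\<^sub>v (z \<cdot>\<^sub>v (B *\<^sub>v ?u))" by simp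
  then have "z' \<cdot>\<^sub>v ?u = z \<cdot>\<^sub>v ?u"
    using mult_mat_vec[OF adjoint_carrier[OF B(1)] Bu] inv by simp
  then have "(z' \<cdot>\<^sub>v ?u) $ 0 = (z \<cdot>\<^sub>v ?u) $ 0" by simp
  then show "z' = z" using B(3) by simp
qed

text \<open>The map from \<open>u\<close> to \<open>l\<close> tensor \<open>A u\<close> commutes
  with the subgroup because the subgroup fixes \<open>l\<close>. Followed by the adjoint of
  \<open>C\<close> it is an intertwiner from \<open>E\<close> to \<open>V'\<close>, and multiplicity
  one forces it to be a multiple of \<open>B\<close>.\<close>

lemma schur_scalar_spec:
  assumes W: "unitary_rep G W" and V: "unitary_rep G V" and V': "unitary_rep G V'"
    and S: "S \<subseteq> carrier G" and H: "H = G\<lparr>carrier := S\<rparr>" and E: "unitary_rep H E" "0 < rdim E"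
    and l: "l \<in> carrier_vec (rdim W)" and l_fix: "\<And>h. h \<in> S \<Longrightarrow> rmat W h *\<^sub>v l = l"
    and A: "A \<in> intertwiners H E V" and B: "B \<in> intertwiners H E V'" "isometric B"
    and mult: "hom_dim H E V' = 1" and C: "C \<in> intertwiners G V' (tensor_rep W V)"
    and u: "u \<in> carrier_vec (rdim E)"
  shows "mat_adjoint C *\<^sub>v tensor_vec l (A *\<^sub>v u) = schur_scalar C l A B \<cdot>\<^sub>v (B *\<^sub>v u)"
proof -
  let ?d = "rdim E" and ?D = "rdim V"
  note Ac = intertwinersD(1)[OF A] and Bc = intertwinersD(1)[OF B(1)]
  have HG: "h \<in> carrier G" if "h \<in> carrier H" for h using that S H by auto
  \<comment> \<open>\<open>M\<close> is the matrix of the map from \<open>u\<close> to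
    \<open>l\<close> tensor \<open>A u\<close>, in Kronecker coordinates.\<close>
  define M where "M = mat (rdim W * ?D) ?d (\<lambda>(i, j). l $ (i div ?D) * A $$ (i mod ?D, j))"
  have M: "M \<in> carrier_mat (rdim W * ?D) ?d" by (simp add: M_def)
  have Mv: "M *\<^sub>v v = tensor_vec l (A *\<^sub>v v)" if v: "v \<in> carrier_vec ?d" for v
  proof (rule eq_vecI)
    fix i assume "i < dim_vec (tensor_vec l (A *\<^sub>v v))"
    then have i: "i < rdim W * ?D" using Ac l by simp
    then show "(M *\<^sub>v v) $ i = tensor_vec l (A *\<^sub>v v) $ i"
      using Ac l v mod_less_of_less_mult[OF i]
      by (simp add: tensor_vec_def mult_vec_index M_def sum_distrib_left mult_ac del: index_mult_mat_vec)
  qed (use Ac l M in auto)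
  note T = tensor_rep_unitary[OF W V]
  have "M \<in> intertwiners H E (tensor_rep W V)"
    unfolding intertwiners_def
  proof (intro CollectI conjI ballI)
    show "M \<in> carrier_mat (rdim (tensor_rep W V)) ?d" using M by (simp add: tensor_rep_def)
    fix h assume h: "h \<in> carrier H"
    note Eh = unitary_rep_carrier[OF E(1) h] and Wh = unitary_rep_carrier[OF W HG[OF h]]
      and Vh = unitary_rep_carrier[OF V HG[OF h]]
    have Th: "rmat (tensor_rep W V) h \<in> carrier_mat (rdim W * ?D) (rdim W * ?D)"
      using Wh Vh by (auto simp: tensor_rep_def)
    show "M * rmat E h = rmat (tensor_rep W V) h * M"
    proof (rule mat_eq_of_mult_vec_eq[OF mult_carrier_mat[OF M Eh] mult_carrier_mat[OF Th M]])
      fix v :: "complex vec" assume v: "v \<in> carrier_vec ?d"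
      have "(M * rmat E h) *\<^sub>v v = tensor_vec l (A *\<^sub>v (rmat E h *\<^sub>v v))"
        using assoc_mult_mat_vec[OF M Eh v] Mv[OF mult_mat_vec_carrier[OF Eh v]] by simp
      also have "A *\<^sub>v (rmat E h *\<^sub>v v) = rmat V h *\<^sub>v (A *\<^sub>v v)"
        using assoc_mult_mat_vec[OF Ac Eh v] assoc_mult_mat_vec[OF Vh Ac v] intertwinersD(2)[OF A h] by simp
      also have "tensor_vec l (rmat V h *\<^sub>v (A *\<^sub>v v)) = tensor_vec (rmat W h *\<^sub>v l) (rmat V h *\<^sub>v (A *\<^sub>v v))"
        using l_fix[of h] h H by simp
      also have "\<dots> = rmat (tensor_rep W V) h *\<^sub>v tensor_vec l (A *\<^sub>v v)"
        using tensor_mat_mult_vec[OF Wh Vh l mult_mat_vec_carrier[OF Ac v]] by (simp add: tensor_rep_def)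
      also have "\<dots> = (rmat (tensor_rep W V) h * M) *\<^sub>v v"
        using assoc_mult_mat_vec[OF Th M v] Mv[OF v] by simp
      finally show "(M * rmat E h) *\<^sub>v v = (rmat (tensor_rep W V) h * M) *\<^sub>v v" .
    qed
  qed
  \<comment> \<open>An intertwiner for \<open>G\<close> is one for \<open>H\<close>: the matrices
    are the same and fewer equations are imposed.\<close>
  moreover have "mat_adjoint C \<in> intertwiners H (tensor_rep W V) V'"
    using adjoint_intertwiner[OF V' T C] HG by (auto simp: intertwiners_def)
  ultimately have CM: "mat_adjoint C * M \<in> intertwiners H E V'"
    using unitary_rep_carrier[OF E(1)] unitary_rep_carrier[OF T HG] unitary_rep_carrier[OF V' HG]
    by (intro intertwiner_mult) auto
  \<comment> \<open>The entry at position (0, 0) of the adjoint of \<open>B\<close> times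
    \<open>B\<close> is 1, and the entry exists because \<open>E\<close> is nonzero.\<close>
  have "B \<noteq> 0\<^sub>m (rdim V') ?d"
  proof
    assume "B = 0\<^sub>m (rdim V') ?d"
    then have "(mat_adjoint B * B) $$ (0, 0) = 0"
      using E(2) by (simp add: mult_index del: index_mult_mat(1))
    moreover have "mat_adjoint B * B = 1\<^sub>m ?d" using B(2) Bc by (simp add: isometric_def)
    ultimately show False using E(2) by simp
  qed
  then obtain z where z: "mat_adjoint C * M = z \<cdot>\<^sub>m B"
    using hom_dim_one_multiple[OF unitary_rep_carrier[OF E(1)] unitary_rep_carrier[OF V' HG] mult B(1) _ CM]
    by blast
  note Cc = intertwinersD(1)[OF C]
  have M': "M \<in> carrier_mat (rdim (tensor_rep W V)) ?d" using M by (simp add: tensor_rep_def)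
  have eq: "mat_adjoint C *\<^sub>v tensor_vec l (A *\<^sub>v v) = z \<cdot>\<^sub>v (B *\<^sub>v v)" if v: "v \<in> carrier_vec ?d" for v
  proof -
    have "mat_adjoint C *\<^sub>v tensor_vec l (A *\<^sub>v v) = (mat_adjoint C * M) *\<^sub>v v"
      using assoc_mult_mat_vec[OF adjoint_carrier[OF Cc] M' v] Mv[OF v] by simp
    also have "\<dots> = z \<cdot>\<^sub>v (B *\<^sub>v v)"
      unfolding z using Bc v by (intro eq_vecI) auto
    finally show ?thesis .
  qed
  have "schur_scalar C l A B = z"
    using carrier_matD(2)[OF Ac] eq by (rule schur_scalar_eq[OF Bc B(2) E(2)])
  then show ?thesis using eq[OF u] by simp
qed

text \<open>Bessel's inequality for the sum \<xi> of the vectors \<open>L x\<close> tensor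
  \<open>v x\<close>. Its components along the copies \<open>C k\<close> are \<open>z k\<close>
  times \<open>R k\<close>, and its squared norm expands into products of inner products of the two
  tensor factors.\<close>

lemma compression_domination:
  assumes W: "unitary_rep G W" and V: "unitary_rep G V"
    and g: "\<And>x. x \<in> K \<Longrightarrow> g x \<in> carrier G"
    and l: "l \<in> carrier_vec (rdim W)" and A: "A \<in> carrier_mat (rdim V) d"
    and \<alpha>: "\<And>x. x \<in> K \<Longrightarrow> \<alpha> x \<in> carrier_vec d"
    and I: "finite I" and U: "\<And>k. k \<in> I \<Longrightarrow> unitary_rep G (U k)" "\<And>k. k \<in> I \<Longrightarrow> irreducible_rep G (U k)"
    and U_inequivalent: "\<And>k k'. k \<in> I \<Longrightarrow> k' \<in> I \<Longrightarrow> k \<noteq> k' \<Longrightarrow> \<not> equivalent_rep G (U k) (U k')"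
    and C: "\<And>k. k \<in> I \<Longrightarrow> C k \<in> intertwiners G (U k) (tensor_rep W V)" "\<And>k. k \<in> I \<Longrightarrow> isometric (C k)"
    and B: "\<And>k. k \<in> I \<Longrightarrow> B k \<in> carrier_mat (rdim (U k)) d"
    and z: "\<And>k u. k \<in> I \<Longrightarrow> u \<in> carrier_vec d \<Longrightarrow>
        mat_adjoint (C k) *\<^sub>v tensor_vec l (A *\<^sub>v u) = z k \<cdot>\<^sub>v (B k *\<^sub>v u)"
  defines "R \<equiv> \<lambda>k. sum_vec (rdim (U k)) (\<lambda>x. rmat (U k) (g x) *\<^sub>v (B k *\<^sub>v \<alpha> x)) K"
    and "v \<equiv> \<lambda>x. rmat V (g x) *\<^sub>v (A *\<^sub>v \<alpha> x)"
  shows "(\<Sum>k\<in>I. (cmod (z k))\<^sup>2 * Re (R k \<bullet>c R k)) \<le>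
    Re (\<Sum>x\<in>K. \<Sum>y\<in>K. ((rmat W (g y) *\<^sub>v l) \<bullet>c (rmat W (g x) *\<^sub>v l)) * (v y \<bullet>c v x))"
proof -
  define L where "L x = rmat W (g x) *\<^sub>v l" for x
  let ?T = "tensor_rep W V" and ?n = "rdim W * rdim V"
  note T = tensor_rep_unitary[OF W V]
  have n: "rdim ?T = ?n" by (simp add: tensor_rep_def)
  have A\<alpha>: "A *\<^sub>v \<alpha> x \<in> carrier_vec (rdim V)" if "x \<in> K" for x
    using A \<alpha>[OF that] by (rule mult_mat_vec_carrier)
  have v: "v x \<in> carrier_vec (rdim V)" if "x \<in> K" for x
    unfolding v_def using unitary_rep_carrier[OF V g[OF that]] A\<alpha>[OF that] by (rule mult_mat_vec_carrier)
  have L: "L x \<in> carrier_vec (rdim W)" if "x \<in> K" for x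
    unfolding L_def using unitary_rep_carrier[OF W g[OF that]] l by (rule mult_mat_vec_carrier)
  have Lv: "tensor_vec (L x) (v x) \<in> carrier_vec ?n" if "x \<in> K" for x
    using L v that by (intro tensor_vec_carrier)
  define \<xi> where "\<xi> = sum_vec ?n (\<lambda>x. tensor_vec (L x) (v x)) K"
  have \<xi>: "\<xi> \<in> carrier_vec ?n" by (simp add: \<xi>_def)
  have adj_\<xi>: "mat_adjoint (C k) *\<^sub>v \<xi> = z k \<cdot>\<^sub>v R k" if k: "k \<in> I" for k
  proof -
    have Cc: "C k \<in> carrier_mat ?n (rdim (U k))" using intertwinersD(1)[OF C(1)[OF k]] n by simp
    have summand: "mat_adjoint (C k) *\<^sub>v tensor_vec (L x) (v x) = z k \<cdot>\<^sub>v (rmat (U k) (g x) *\<^sub>v (B k *\<^sub>v \<alpha> x))"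
      if x: "x \<in> K" for x
    proof -
      note Wx = unitary_rep_carrier[OF W g[OF x]] and Vx = unitary_rep_carrier[OF V g[OF x]]
        and Ux = unitary_rep_carrier[OF U(1)[OF k] g[OF x]]
      have Tx: "rmat ?T (g x) \<in> carrier_mat ?n ?n" using Wx Vx by (auto simp: tensor_rep_def)
      have lA: "tensor_vec l (A *\<^sub>v \<alpha> x) \<in> carrier_vec ?n" using l A\<alpha>[OF x] by (rule tensor_vec_carrier)
      have BA: "B k *\<^sub>v \<alpha> x \<in> carrier_vec (rdim (U k))"
        using B[OF k] \<alpha>[OF x] by (rule mult_mat_vec_carrier)
      \<comment> \<open>Both factors are moved by the same \<open>g x\<close>, so the tensor at
        \<open>x\<close> is the translate of the one at the base point. The adjoint of
        \<open>C k\<close> commutes with this translation, which reduces the claim to the scalar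
        relation \<open>z\<close>.\<close>
      have "tensor_vec (L x) (v x) = rmat ?T (g x) *\<^sub>v tensor_vec l (A *\<^sub>v \<alpha> x)"
        using tensor_mat_mult_vec[OF Wx Vx l A\<alpha>[OF x]] by (simp add: tensor_rep_def L_def v_def)
      then have "mat_adjoint (C k) *\<^sub>v tensor_vec (L x) (v x) =
          (mat_adjoint (C k) * rmat ?T (g x)) *\<^sub>v tensor_vec l (A *\<^sub>v \<alpha> x)"
        using assoc_mult_mat_vec[OF adjoint_carrier[OF Cc] Tx lA] by simp
      also have "mat_adjoint (C k) * rmat ?T (g x) = rmat (U k) (g x) * mat_adjoint (C k)"
        by (rule intertwinersD(2)[OF adjoint_intertwiner[OF U(1)[OF k] T C(1)[OF k]] g[OF x]])
      also have "(rmat (U k) (g x) * mat_adjoint (C k)) *\<^sub>v tensor_vec l (A *\<^sub>v \<alpha> x) =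
          rmat (U k) (g x) *\<^sub>v (mat_adjoint (C k) *\<^sub>v tensor_vec l (A *\<^sub>v \<alpha> x))"
        by (rule assoc_mult_mat_vec[OF Ux adjoint_carrier[OF Cc] lA])
      also have "\<dots> = z k \<cdot>\<^sub>v (rmat (U k) (g x) *\<^sub>v (B k *\<^sub>v \<alpha> x))"
        unfolding z[OF k \<alpha>[OF x]] by (rule mult_mat_vec[OF Ux BA])
      finally show ?thesis .
    qed
    have "mat_adjoint (C k) *\<^sub>v \<xi> = sum_vec (rdim (U k)) (\<lambda>x. mat_adjoint (C k) *\<^sub>v tensor_vec (L x) (v x)) K"
      unfolding \<xi>_def using adjoint_carrier[OF Cc] Lv by (rule mult_sum_vec)
    also have "\<dots> = sum_vec (rdim (U k)) (\<lambda>x. z k \<cdot>\<^sub>v (rmat (U k) (g x) *\<^sub>v (B k *\<^sub>v \<alpha> x))) K"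
      by (rule sum_vec_cong) (rule summand)
    also have "\<dots> = z k \<cdot>\<^sub>v R k"
    proof (rule eq_vecI)
      fix i assume "i < dim_vec (z k \<cdot>\<^sub>v R k)"
      then have i: "i < rdim (U k)" by (simp add: R_def)
      have "(z k \<cdot>\<^sub>v (rmat (U k) (g x) *\<^sub>v (B k *\<^sub>v \<alpha> x))) $ i = z k * (rmat (U k) (g x) *\<^sub>v (B k *\<^sub>v \<alpha> x)) $ i"
        if "x \<in> K" for x
        using i unitary_rep_carrier[OF U(1)[OF k] g[OF that]] by simp
      then show "sum_vec (rdim (U k)) (\<lambda>x. z k \<cdot>\<^sub>v (rmat (U k) (g x) *\<^sub>v (B k *\<^sub>v \<alpha> x))) K $ i = (z k \<cdot>\<^sub>v R k) $ i"
        using i by (simp add: R_def sum_distrib_left del: index_mult_mat_vec index_smult_vec(1))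
          (simp add: R_def sum_distrib_left)
    qed (simp add: R_def)
    finally show ?thesis .
  qed
  have "Re ((mat_adjoint (C k) *\<^sub>v \<xi>) \<bullet>c (mat_adjoint (C k) *\<^sub>v \<xi>)) = (cmod (z k))\<^sup>2 * Re (R k \<bullet>c R k)"
    if "k \<in> I" for k
    unfolding adj_\<xi>[OF that] cscalar_self
    by (simp add: norm_mult power_mult_distrib sum_distrib_left)
  then have "(\<Sum>k\<in>I. (cmod (z k))\<^sup>2 * Re (R k \<bullet>c R k)) =
      (\<Sum>k\<in>I. Re ((mat_adjoint (C k) *\<^sub>v \<xi>) \<bullet>c (mat_adjoint (C k) *\<^sub>v \<xi>)))"
    by simp
  also have "\<dots> \<le> Re (\<xi> \<bullet>c \<xi>)"
  proof (rule bessel_isometries[OF I _ C(2) _ \<xi>])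
    show "C k \<in> carrier_mat ?n (rdim (U k))" if "k \<in> I" for k
      using intertwinersD(1)[OF C(1)[OF that]] n by simp
    \<comment> \<open>The product intertwines two inequivalent irreducible representations, so
      Schur's lemma gives orthogonality of the copies.\<close>
    show "mat_adjoint (C k) * C k' = 0\<^sub>m (rdim (U k)) (rdim (U k'))"
      if k: "k \<in> I" "k' \<in> I" "k \<noteq> k'" for k k'
    proof (rule schur_intertwiner_zero[OF U(1)[OF k(2)] U(2)[OF k(2)] U(1)[OF k(1)] U(2)[OF k(1)]])
      show "\<not> equivalent_rep G (U k') (U k)" using U_inequivalent k by blast
      show "mat_adjoint (C k) * C k' \<in> intertwiners G (U k') (U k)"
        by (rule intertwiner_mult[OF unitary_rep_carrier[OF U(1)[OF k(2)]] unitary_rep_carrier[OF T]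
              unitary_rep_carrier[OF U(1)[OF k(1)]] C(1)[OF k(2)] adjoint_intertwiner[OF U(1)[OF k(1)] T C(1)[OF k(1)]]])
    qed
  qed
  also have "\<xi> \<bullet>c \<xi> = (\<Sum>y\<in>K. \<Sum>x\<in>K. (L y \<bullet>c L x) * (v y \<bullet>c v x))"
  proof -
    have "\<xi> \<bullet>c \<xi> = (\<Sum>y\<in>K. tensor_vec (L y) (v y) \<bullet>c \<xi>)"
      using cscalar_sum_vec_left[OF \<xi> Lv] by (simp add: \<xi>_def)
    also have "\<dots> = (\<Sum>y\<in>K. \<Sum>x\<in>K. tensor_vec (L y) (v y) \<bullet>c tensor_vec (L x) (v x))"
      by (intro sum.cong refl) (simp add: \<xi>_def cscalar_sum_vec_right[OF Lv Lv])
    also have "\<dots> = (\<Sum>y\<in>K. \<Sum>x\<in>K. (L y \<bullet>c L x) * (v y \<bullet>c v x))"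
      by (intro sum.cong refl) (simp add: cscalar_tensor_vec[OF L L v v])
    finally show ?thesis .
  qed
  also have "\<dots> = (\<Sum>x\<in>K. \<Sum>y\<in>K. (L y \<bullet>c L x) * (v y \<bullet>c v x))" by (rule sum.swap)
  finally show ?thesis by (simp add: L_def)
qed

theorem theorem2p1:
  fixes G :: "('g, 'm) monoid_scheme"
    and X :: "'x set" and act :: "'g \<Rightarrow> 'x \<Rightarrow> 'x" and x0 :: 'x
    and H :: "('g, 'm) monoid_scheme"
    and W E :: "'g rep"
    and l :: "'x \<Rightarrow> complex vec" and t :: "'x \<Rightarrow> 'x \<Rightarrow> real"
    and \<Omega> :: "'i set" and V :: "'i \<Rightarrow> 'g rep"
    and \<phi> :: "'i \<Rightarrow> complex mat" and C :: "'i \<Rightarrow> 'i \<Rightarrow> complex mat"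
    and c :: "'i \<Rightarrow> 'i \<Rightarrow> complex" and p :: "'i \<Rightarrow> 'i \<Rightarrow> real"
    and s :: real
  assumes action: "transitive_action G X act" "finite (carrier G)" "finite X" "x0 \<in> X"
    and H: "H = G\<lparr>carrier := stabilizer G act x0\<rparr>"
    and W: "unitary_rep G W"
    and l_carrier: "\<And>x. x \<in> X \<Longrightarrow> l x \<in> carrier_vec (rdim W)"
    and l_equivariant: "\<And>g x. g \<in> carrier G \<Longrightarrow> x \<in> X \<Longrightarrow> l (act g x) = rmat W g *\<^sub>v l x"
    and l_unit: "\<And>x. x \<in> X \<Longrightarrow> l x \<bullet>c l x = 1"
    and l_real: "\<And>x y. x \<in> X \<Longrightarrow> y \<in> X \<Longrightarrow> l x \<bullet>c l y \<in> \<real>"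
    and t: "\<And>x y. x \<in> X \<Longrightarrow> y \<in> X \<Longrightarrow> t x y = Re (l x \<bullet>c l y)"
    and E: "unitary_rep H E" "irreducible_rep H E"
    and \<Omega>: "finite \<Omega>" "\<Omega> \<noteq> {}"
    and V: "\<And>\<omega>. \<omega> \<in> \<Omega> \<Longrightarrow> unitary_rep G (V \<omega>)"
           "\<And>\<omega>. \<omega> \<in> \<Omega> \<Longrightarrow> irreducible_rep G (V \<omega>)"
    and V_inequivalent:
      "\<And>\<omega> \<omega>'. \<omega> \<in> \<Omega> \<Longrightarrow> \<omega>' \<in> \<Omega> \<Longrightarrow> \<omega> \<noteq> \<omega>' \<Longrightarrow> \<not> equivalent_rep G (V \<omega>) (V \<omega>')"
    and V_multiplicity: "\<And>\<omega>. \<omega> \<in> \<Omega> \<Longrightarrow> hom_dim H E (V \<omega>) = 1"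
    and \<phi>: "\<And>\<omega>. \<omega> \<in> \<Omega> \<Longrightarrow> \<phi> \<omega> \<in> intertwiners H E (V \<omega>)"
           "\<And>\<omega>. \<omega> \<in> \<Omega> \<Longrightarrow> isometric (\<phi> \<omega>)"
    and C: "\<And>\<omega> \<omega>'. \<omega> \<in> \<Omega> \<Longrightarrow> \<omega>' \<in> \<Omega> \<Longrightarrow> occurs_in G (V \<omega>') (tensor_rep W (V \<omega>)) \<Longrightarrow>
              C \<omega> \<omega>' \<in> intertwiners G (V \<omega>') (tensor_rep W (V \<omega>)) \<and> isometric (C \<omega> \<omega>')"
    and c: "\<And>\<omega> \<omega>'. \<omega> \<in> \<Omega> \<Longrightarrow> \<omega>' \<in> \<Omega> \<Longrightarrow> occurs_in G (V \<omega>') (tensor_rep W (V \<omega>)) \<Longrightarrow>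
              c \<omega> \<omega>' = schur_scalar (C \<omega> \<omega>') (l x0) (\<phi> \<omega>) (\<phi> \<omega>')"
    and c_phase: "\<And>\<omega> \<omega>'. \<omega> \<in> \<Omega> \<Longrightarrow> \<omega>' \<in> \<Omega> \<Longrightarrow> occurs_in G (V \<omega>') (tensor_rep W (V \<omega>)) \<Longrightarrow>
              c \<omega> \<omega>' \<in> \<real>\<^sub>\<ge>\<^sub>0"
    and p: "\<And>\<omega> \<omega>'. \<omega> \<in> \<Omega> \<Longrightarrow> \<omega>' \<in> \<Omega> \<Longrightarrow>
              p \<omega> \<omega>' = (if occurs_in G (V \<omega>') (tensor_rep W (V \<omega>)) then (Re (c \<omega> \<omega>'))\<^sup>2 else 0)"
    and balance: "\<And>\<omega> \<omega>'. \<omega> \<in> \<Omega> \<Longrightarrow> \<omega>' \<in> \<Omega> \<Longrightarrow>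
              real (rdim (V \<omega>)) * p \<omega> \<omega>' = real (rdim (V \<omega>')) * p \<omega>' \<omega>"
  shows "\<forall>K. K \<subseteq> X \<and> (\<forall>x\<in>K. \<forall>y\<in>K. x \<noteq> y \<longrightarrow> t x y \<le> s) \<longrightarrow>
      (\<forall>w. (\<forall>\<omega>\<in>\<Omega>. 0 < w \<omega>) \<and> max s 0 < profile_eigenvalue \<Omega> p w \<longrightarrow>
         real (card K) \<le> (1 - s) / (real (rdim E) * (profile_eigenvalue \<Omega> p w - s))
                          * effective_dim \<Omega> (\<lambda>\<omega>. rdim (V \<omega>)) w) \<and>
      ereal (real (card K)) \<le>
        (INF w \<in> {w. (\<forall>\<omega>\<in>\<Omega>. 0 < w \<omega>) \<and> max s 0 < profile_eigenvalue \<Omega> p w}.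
           ereal ((1 - s) / (real (rdim E) * (profile_eigenvalue \<Omega> p w - s))
                  * effective_dim \<Omega> (\<lambda>\<omega>. rdim (V \<omega>)) w))"
proof -

  \<comment> \<open>Coset representatives and Schur scalars\<close>
  interpret transitive_action G X act by (rule action(1))
  let ?S = "stabilizer G act x0"
  define d where "d = rdim E"
  define D where "D \<omega> = rdim (V \<omega>)" for \<omega>
  \<comment> \<open>\<open>C \<omega> \<omega>'\<close> and \<open>c \<omega> \<omega>'\<close> are
    constrained only for representations that occur, so statements about them are restricted to
    \<open>Occ \<omega>\<close>.\<close>
  define Occ where "Occ \<omega> = {\<omega>' \<in> \<Omega>. occurs_in G (V \<omega>') (tensor_rep W (V \<omega>))}" for \<omega>
  have d: "0 < d" using E(2) by (simp add: irreducible_rep_def d_def)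
  have D: "0 < D \<omega>" if "\<omega> \<in> \<Omega>" for \<omega> using V(2)[OF that] by (simp add: irreducible_rep_def D_def)
  \<comment> \<open>Transitivity supplies for each point an element carrying the base point to
    it.\<close>
  obtain g where g: "\<And>x. x \<in> X \<Longrightarrow> g x \<in> carrier G" "\<And>x. x \<in> X \<Longrightarrow> act (g x) x0 = x"
    using unique_orbit[OF action(4)] by metis
  have lg: "l x = rmat W (g x) *\<^sub>v l x0" if "x \<in> X" for x
    using l_equivariant[OF g(1)[OF that] action(4)] g(2)[OF that] by simp
  have \<phi>_carrier: "\<phi> \<omega> \<in> carrier_mat (D \<omega>) d" if "\<omega> \<in> \<Omega>" for \<omega>
    using intertwinersD(1)[OF \<phi>(1)[OF that]] by (simp add: D_def d_def)
  have Vg: "rmat (V \<omega>) (g x) \<in> carrier_mat (D \<omega>) (D \<omega>)" "isometric (rmat (V \<omega>) (g x))"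
    if "\<omega> \<in> \<Omega>" "x \<in> X" for \<omega> x
    using V(1)[OF that(1)] g(1)[OF that(2)] by (auto simp: unitary_rep_def D_def)

  have scalar: "mat_adjoint (C \<omega> \<omega>') *\<^sub>v tensor_vec (l x0) (\<phi> \<omega> *\<^sub>v u) = c \<omega> \<omega>' \<cdot>\<^sub>v (\<phi> \<omega>' *\<^sub>v u)"
    if \<omega>: "\<omega> \<in> \<Omega>" and \<omega>': "\<omega>' \<in> Occ \<omega>" and u: "u \<in> carrier_vec d" for \<omega> \<omega>' u
  proof -
    have \<omega>'\<Omega>: "\<omega>' \<in> \<Omega>" and occ: "occurs_in G (V \<omega>') (tensor_rep W (V \<omega>))"
      using \<omega>' by (auto simp: Occ_def)
    \<comment> \<open>The stabilizer fixes \<open>x0\<close>, and equivariance transfers this to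
      \<open>l x0\<close>.\<close>
    have fix_l: "rmat W h *\<^sub>v l x0 = l x0" if "h \<in> ?S" for h
      using l_equivariant[of h x0] that action(4) by (simp add: stabilizer_def)
    show ?thesis
      unfolding c[OF \<omega> \<omega>'\<Omega> occ]
      by (rule schur_scalar_spec[OF W V(1)[OF \<omega>] V(1)[OF \<omega>'\<Omega>] stabilizer_subset H E(1) _
            l_carrier[OF action(4)] fix_l \<phi>(1)[OF \<omega>] \<phi>(1)[OF \<omega>'\<Omega>] \<phi>(2)[OF \<omega>'\<Omega>]
            V_multiplicity[OF \<omega>'\<Omega>] conjunct1[OF C[OF \<omega> \<omega>'\<Omega> occ]]])
        (use d u in \<open>auto simp: d_def\<close>)
  qed

  \<comment> \<open>The bound for nonempty codes\<close>
  have code_bound: "real (card K) \<le> (1 - s) / (real d * (profile_eigenvalue \<Omega> p w - s)) * effective_dim \<Omega> D w"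
    if KX: "K \<subseteq> X" and K: "K \<noteq> {}" and sep: "\<forall>x\<in>K. \<forall>y\<in>K. x \<noteq> y \<longrightarrow> t x y \<le> s"
      and w: "\<forall>\<omega>\<in>\<Omega>. 0 < w \<omega>" and gap: "max s 0 < profile_eigenvalue \<Omega> p w" for K w
  proof -
    define lam where "lam = profile_eigenvalue \<Omega> p w"
    \<comment> \<open>The isometric copy of \<open>E\<close> at the point \<open>x\<close>,
      transported from the base point.\<close>
    define \<Phi> where "\<Phi> \<omega> x = rmat (V \<omega>) (g x) * \<phi> \<omega>" for \<omega> x
    have finK: "finite K" using KX action(3) by (rule finite_subset)
    have \<Phi>: "\<Phi> \<omega> x \<in> carrier_mat (D \<omega>) d" "isometric (\<Phi> \<omega> x)" if "\<omega> \<in> \<Omega>" "x \<in> K" for \<omega> x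
    proof -
      have x: "x \<in> X" using that KX by auto
      show "\<Phi> \<omega> x \<in> carrier_mat (D \<omega>) d"
        unfolding \<Phi>_def by (rule mult_carrier_mat[OF Vg(1)[OF that(1) x] \<phi>_carrier[OF that(1)]])
      show "isometric (\<Phi> \<omega> x)"
        unfolding \<Phi>_def by (rule isometric_mult[OF Vg[OF that(1) x] \<phi>_carrier[OF that(1)] \<phi>(2)[OF that(1)]])
    qed
    have lam_le: "lam * w \<nu> \<le> (\<Sum>\<omega>\<in>\<Omega>. p \<omega> \<nu> * w \<omega>)" if "\<nu> \<in> \<Omega>" for \<nu>
    proof -
      have "lam \<le> (\<Sum>\<omega>\<in>\<Omega>. p \<omega> \<nu> * w \<omega>) / w \<nu>"
        unfolding lam_def profile_eigenvalue_def using \<Omega>(1) that by (intro Min_le) auto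
      then show ?thesis using w that by (simp add: pos_le_divide_eq)
    qed
    \<comment> \<open>The expanded norm lists the vector at \<open>y\<close> first. The two orders
      agree because the inner product is real.\<close>
    have tl: "l y \<bullet>c l x = complex_of_real (t x y)" if "x \<in> K" "y \<in> K" for x y
    proof -
      have xy: "x \<in> X" "y \<in> X" using that KX by auto
      have "l y \<bullet>c l x = cnj (l x \<bullet>c l y)"
        using l_carrier[OF xy(1)] l_carrier[OF xy(2)] by (simp add: cscalar_index mult.commute)
      also have "\<dots> = l x \<bullet>c l y" using l_real[OF xy] by (simp add: Reals_cnj_iff)
      also have "\<dots> = complex_of_real (t x y)" using l_real[OF xy] t[OF xy] by simp
      finally show ?thesis .
    qed
    show ?thesis
      unfolding lam_def[symmetric]
    proof (rule frame_code_bound[OF finK K \<Omega> _ D d, where f = "\<lambda>\<omega> x i e. \<Phi> \<omega> x $$ (i, e)" and t = t])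
      show "0 < w \<omega>" if "\<omega> \<in> \<Omega>" for \<omega> using w that by simp
      show "(\<Sum>i<D \<omega>. cnj (\<Phi> \<omega> x $$ (i, e)) * \<Phi> \<omega> x $$ (i, e')) = (if e = e' then 1 else 0)"
        if "\<omega> \<in> \<Omega>" "x \<in> K" "e < d" "e' < d" for \<omega> x e e'
        using isometric_cols_orthonormal[OF \<Phi>[OF that(1,2)] that(3,4)] .
      show "t x x = 1" if "x \<in> K" for x using t[of x x] l_unit[of x] that KX by auto
      show "t x y \<le> s" if "x \<in> K" "y \<in> K" "x \<noteq> y" for x y using sep that by auto
      show "s < lam" using gap by (simp add: lam_def)
      fix a :: "'x \<Rightarrow> nat \<Rightarrow> complex"
      \<comment> \<open>The coefficients \<open>a x\<close> are read as a vector of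
        \<open>E\<close>. Then \<open>v \<omega> x\<close> is its image in the copy at
        \<open>x\<close>, and \<open>q \<omega>\<close> is the squared norm of the sum
        \<open>R \<omega>\<close> of these images over the code.\<close>
      define \<alpha> where "\<alpha> x = vec d (a x)" for x
      define v where "v \<omega> x = rmat (V \<omega>) (g x) *\<^sub>v (\<phi> \<omega> *\<^sub>v \<alpha> x)" for \<omega> x
      define R where "R \<omega> = sum_vec (D \<omega>) (v \<omega>) K" for \<omega>
      define q where "q \<omega> = Re (R \<omega> \<bullet>c R \<omega>)" for \<omega>
      define r where "r \<omega> = (\<Sum>x\<in>K. \<Sum>y\<in>K. of_real (t x y) * (v \<omega> y \<bullet>c v \<omega> x))" for \<omega>
      have \<alpha>: "\<alpha> x \<in> carrier_vec d" for x by (simp add: \<alpha>_def)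
      have v\<Phi>: "v \<omega> x = \<Phi> \<omega> x *\<^sub>v \<alpha> x" if "\<omega> \<in> \<Omega>" "x \<in> K" for \<omega> x
        unfolding v_def \<Phi>_def using that KX
        by (intro assoc_mult_mat_vec[symmetric, OF Vg(1) \<phi>_carrier \<alpha>]) auto
      have v_index: "(\<Sum>e<d. \<Phi> \<omega> x $$ (i, e) * a x e) = v \<omega> x $ i"
        if "\<omega> \<in> \<Omega>" "x \<in> K" "i < D \<omega>" for \<omega> x i
        using \<Phi>(1)[OF that(1,2)] that(3)
        by (simp add: v\<Phi>[OF that(1,2)] mult_vec_index \<alpha>_def del: index_mult_mat_vec)
      have v_dim: "dim_vec (v \<omega> x) = D \<omega>" if "\<omega> \<in> \<Omega>" "x \<in> K" for \<omega> x
        using \<Phi>(1)[OF that] by (simp add: v\<Phi>[OF that])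
      have norm_R: "(\<Sum>i<D \<omega>. (cmod (\<Sum>x\<in>K. \<Sum>e<d. \<Phi> \<omega> x $$ (i, e) * a x e))\<^sup>2) = q \<omega>"
        if "\<omega> \<in> \<Omega>" for \<omega>
        by (simp add: q_def cscalar_self R_def v_index[OF that])
      have inner_v: "(\<Sum>i<D \<omega>. cnj (\<Sum>e<d. \<Phi> \<omega> x $$ (i, e) * a x e) * (\<Sum>e<d. \<Phi> \<omega> y $$ (i, e) * a y e)) =
          v \<omega> y \<bullet>c v \<omega> x" if "\<omega> \<in> \<Omega>" "x \<in> K" "y \<in> K" for \<omega> x y
      proof -
        have "v \<omega> y \<bullet>c v \<omega> x = (\<Sum>i<D \<omega>. cnj (v \<omega> x $ i) * v \<omega> y $ i)"
          by (simp add: cscalar_index v_dim[OF that(1,2)] mult.commute)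
        then show ?thesis
          by (simp only:) (intro sum.cong refl, simp only: lessThan_iff v_index[OF that(1,2)] v_index[OF that(1,3)])
      qed
      have q0: "0 \<le> q \<omega>" for \<omega> by (simp add: q_def cscalar_self sum_nonneg)
      have dominated: "(\<Sum>\<nu>\<in>\<Omega>. p \<omega> \<nu> * q \<nu>) \<le> Re (r \<omega>)" if \<omega>: "\<omega> \<in> \<Omega>" for \<omega>
      proof -
        \<comment> \<open>The phase convention makes \<open>c\<close> a nonnegative real, so the
          square of its real part is its squared modulus, the factor that appears in Bessel's
          inequality.\<close>
        have p_Occ: "p \<omega> \<nu> = (if \<nu> \<in> Occ \<omega> then (cmod (c \<omega> \<nu>))\<^sup>2 else 0)"
          if \<nu>: "\<nu> \<in> \<Omega>" for \<nu>
        proof (cases "\<nu> \<in> Occ \<omega>")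
          case True
          then have occ: "occurs_in G (V \<nu>) (tensor_rep W (V \<omega>))" by (simp add: Occ_def)
          obtain z where "c \<omega> \<nu> = of_real z" using c_phase[OF \<omega> \<nu> occ] by (elim nonneg_Reals_cases)
          then show ?thesis using p[OF \<omega> \<nu>] occ True by simp
        next
          case False
          then show ?thesis using p[OF \<omega> \<nu>] \<nu> by (simp add: Occ_def)
        qed
        have "(\<Sum>\<nu>\<in>\<Omega>. p \<omega> \<nu> * q \<nu>) = (\<Sum>\<nu>\<in>\<Omega>. if \<nu> \<in> Occ \<omega> then (cmod (c \<omega> \<nu>))\<^sup>2 * q \<nu> else 0)"
          by (intro sum.cong) (auto simp: p_Occ)
        also have "\<dots> = (\<Sum>\<nu>\<in>Occ \<omega>. (cmod (c \<omega> \<nu>))\<^sup>2 * q \<nu>)"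
          using \<Omega>(1) by (intro sum.mono_neutral_cong_right) (auto simp: Occ_def)
        also have "\<dots> \<le> Re (\<Sum>x\<in>K. \<Sum>y\<in>K.
            ((rmat W (g y) *\<^sub>v l x0) \<bullet>c (rmat W (g x) *\<^sub>v l x0)) * (v \<omega> y \<bullet>c v \<omega> x))"
          unfolding q_def R_def D_def v_def
        proof (rule compression_domination[OF W V(1)[OF \<omega>] g(1) l_carrier[OF action(4)]
              \<phi>_carrier[OF \<omega>, unfolded D_def] \<alpha>, where C = "C \<omega>"])
          show "x \<in> X" if "x \<in> K" for x using that KX by auto
          show "finite (Occ \<omega>)" using \<Omega>(1) by (simp add: Occ_def)
          fix \<nu> assume \<nu>: "\<nu> \<in> Occ \<omega>"
          then have \<nu>\<Omega>: "\<nu> \<in> \<Omega>" and occ: "occurs_in G (V \<nu>) (tensor_rep W (V \<omega>))" by (auto simp: Occ_def)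
          show "unitary_rep G (V \<nu>)" "irreducible_rep G (V \<nu>)" using V \<nu>\<Omega> by auto
          show "C \<omega> \<nu> \<in> intertwiners G (V \<nu>) (tensor_rep W (V \<omega>))" "isometric (C \<omega> \<nu>)"
            using C[OF \<omega> \<nu>\<Omega> occ] by auto
          show "\<phi> \<nu> \<in> carrier_mat (rdim (V \<nu>)) d" using \<phi>_carrier[OF \<nu>\<Omega>] by (simp add: D_def)
          show "\<not> equivalent_rep G (V \<nu>) (V \<nu>')" if "\<nu>' \<in> Occ \<omega>" "\<nu> \<noteq> \<nu>'" for \<nu>'
            using V_inequivalent[OF \<nu>\<Omega> _ that(2)] that(1) by (simp add: Occ_def)
          show "mat_adjoint (C \<omega> \<nu>) *\<^sub>v tensor_vec (l x0) (\<phi> \<omega> *\<^sub>v u) = c \<omega> \<nu> \<cdot>\<^sub>v (\<phi> \<nu> *\<^sub>v u)"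
            if "u \<in> carrier_vec d" for u using scalar[OF \<omega> \<nu> that] .
        qed
        also have "(\<Sum>x\<in>K. \<Sum>y\<in>K. ((rmat W (g y) *\<^sub>v l x0) \<bullet>c (rmat W (g x) *\<^sub>v l x0)) * (v \<omega> y \<bullet>c v \<omega> x)) = r \<omega>"
          unfolding r_def using KX
          by (intro sum.cong refl) (simp add: tl[symmetric] lg subset_iff)
        finally show ?thesis .
      qed
      \<comment> \<open>The inequalities \<open>dominated\<close> are summed with weights
        \<open>w \<omega>\<close>. After exchanging the sums, the coefficient of
        \<open>q \<nu>\<close> is the numerator of the quotient in
        \<open>profile_eigenvalue\<close>, which \<open>lam_le\<close> bounds below by
        \<open>lam * w \<nu>\<close>; nonnegativity of \<open>q \<nu>\<close> preserves the
        direction.\<close>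
      have "lam * (\<Sum>\<nu>\<in>\<Omega>. w \<nu> * q \<nu>) = (\<Sum>\<nu>\<in>\<Omega>. (lam * w \<nu>) * q \<nu>)"
        by (simp add: sum_distrib_left mult_ac)
      also have "\<dots> \<le> (\<Sum>\<nu>\<in>\<Omega>. (\<Sum>\<omega>\<in>\<Omega>. p \<omega> \<nu> * w \<omega>) * q \<nu>)"
        by (intro sum_mono mult_right_mono lam_le q0)
      also have "\<dots> = (\<Sum>\<nu>\<in>\<Omega>. \<Sum>\<omega>\<in>\<Omega>. w \<omega> * (p \<omega> \<nu> * q \<nu>))"
        by (simp add: sum_distrib_left mult_ac)
      also have "\<dots> = (\<Sum>\<omega>\<in>\<Omega>. \<Sum>\<nu>\<in>\<Omega>. w \<omega> * (p \<omega> \<nu> * q \<nu>))" by (rule sum.swap)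
      also have "\<dots> = (\<Sum>\<omega>\<in>\<Omega>. w \<omega> * (\<Sum>\<nu>\<in>\<Omega>. p \<omega> \<nu> * q \<nu>))" by (simp add: sum_distrib_left)
      also have "\<dots> \<le> (\<Sum>\<omega>\<in>\<Omega>. w \<omega> * Re (r \<omega>))"
        using w by (intro sum_mono mult_left_mono dominated) (auto simp: less_imp_le)
      also have "\<dots> = Re (\<Sum>\<omega>\<in>\<Omega>. of_real (w \<omega>) * r \<omega>)" by simp
      also have "(\<Sum>\<nu>\<in>\<Omega>. w \<nu> * q \<nu>) =
          (\<Sum>\<omega>\<in>\<Omega>. w \<omega> * (\<Sum>i<D \<omega>. (cmod (\<Sum>x\<in>K. \<Sum>e<d. \<Phi> \<omega> x $$ (i, e) * a x e))\<^sup>2))"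
        by (intro sum.cong refl) (simp only: norm_R)
      also have "(\<Sum>\<omega>\<in>\<Omega>. of_real (w \<omega>) * r \<omega>) = (\<Sum>\<omega>\<in>\<Omega>. of_real (w \<omega>) * (\<Sum>x\<in>K. \<Sum>y\<in>K. of_real (t x y) *
          (\<Sum>i<D \<omega>. cnj (\<Sum>e<d. \<Phi> \<omega> x $$ (i, e) * a x e) * (\<Sum>e<d. \<Phi> \<omega> y $$ (i, e) * a y e))))"
        unfolding r_def by (intro sum.cong refl arg_cong2[where f = "(*)"]) (simp only: inner_v)
      finally show "lam * (\<Sum>\<omega>\<in>\<Omega>. w \<omega> * (\<Sum>i<D \<omega>. (cmod (\<Sum>x\<in>K. \<Sum>e<d. \<Phi> \<omega> x $$ (i, e) * a x e))\<^sup>2))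
        \<le> Re (\<Sum>\<omega>\<in>\<Omega>. of_real (w \<omega>) * (\<Sum>x\<in>K. \<Sum>y\<in>K. of_real (t x y) *
          (\<Sum>i<D \<omega>. cnj (\<Sum>e<d. \<Phi> \<omega> x $$ (i, e) * a x e) * (\<Sum>e<d. \<Phi> \<omega> y $$ (i, e) * a y e))))" .
    qed
  qed

  \<comment> \<open>Arbitrary codes and the infimum\<close>
  have bound: "real (card K) \<le> (1 - s) / (real (rdim E) * (profile_eigenvalue \<Omega> p w - s))
      * effective_dim \<Omega> (\<lambda>\<omega>. rdim (V \<omega>)) w"
    if "K \<subseteq> X" "\<forall>x\<in>K. \<forall>y\<in>K. x \<noteq> y \<longrightarrow> t x y \<le> s"
      "\<forall>\<omega>\<in>\<Omega>. 0 < w \<omega>" "max s 0 < profile_eigenvalue \<Omega> p w" for K w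
  proof (cases "K = {}")
    case True
    \<comment> \<open>The bound for a one-point code shows that the right-hand side is not negative.\<close>
    have "real (card {x0}) \<le> (1 - s) / (real d * (profile_eigenvalue \<Omega> p w - s)) * effective_dim \<Omega> D w"
      using action(4) that(3,4) by (intro code_bound) auto
    then show ?thesis using True by (simp add: d_def D_def[abs_def])
  next
    case False
    then show ?thesis using code_bound[OF that(1) False that(2-4)] by (simp add: d_def D_def[abs_def])
  qed
  \<comment> \<open>The code size is a lower bound for the values at all admissible profiles. If
    there is no such profile, the infimum in \<open>ereal\<close> is plus infinity.\<close>
  then show ?thesis by (auto intro!: INF_greatest)
qed

end
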